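(* Let $(X,\mathcal A)$, $(Y,\mathcal B)$ be two Polish spaces with Borel $\sigma$-algebras. Let $c\colon X\times Y\to\mathbb R$ be a measurable function such that the functional $Cost\colon\mathcal P(X\times Y)\to\mathbb R\cup\{+\infty\}$, $Cost(\pi)=\int c\,d\pi$, is lower semicontinuous with respect to the topology of weak convergence. Let $M^X\subseteq\mathcal P(X)$, $M^Y\subseteq\mathcal P(Y)$ be two ergodic decomposable simplexes, with corresponding $H$-sufficient $\sigma$-subalgebras $\mathcal A^0\subseteq\mathcal A$, $\mathcal B^0\subseteq\mathcal B$ and associated Markov kernels $Q_X,Q_Y$; write $\xi(x)=Q_X^x$, $\eta(y)=Q_Y^y$. Let $R=(\Omega,M^X,M^Y)$ be a linear restriction that is weakly regular, ergodic decomposable, and coherent with respect to $M$, where $M\subseteq\mathcal P(X\times Y)$ is the associated ergodic decomposable simplex, with associated Markov kernel $Q_M$ and $H$-sufficient $\sigma$-algebra $(\mathcal A\otimes\mathcal B)^0\subseteq\mathcal A\otimes\mathcal B$. Let $\mu\in M^X$, $\nu\in M^Y$, and let $\tilde\mu$, $\tilde\nu$ be the restrictions of $\mu$, $\nu$ to $\mathcal A^0$, $\mathcal B^0$. Let $Q_{opt}$ be an optimal Markov transition kernel as defined in the context (such a kernel exists under the present hypotheses). Then $$\inf\Big\{\int c\,d\pi:\pi\in\Pi_R(\mu,\nu)\Big\}=\inf\Big\{\int Q_{opt}(c)\,d\tilde\pi:\tilde\pi\in\tilde\Pi(\tilde\mu,\tilde\nu)\Big\}$$ $$=\inf\Big\{\int\inf\Big\{\int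 c\,d\pi:\pi\in\Pi_R(\xi(x),\eta(y))\Big\}\,d\tilde\pi(x,y):\tilde\pi\in\tilde\Pi(\tilde\mu,\tilde\nu)\Big\}.$$
   Context: General notions. $\mathcal P(Z)$ is the set of probability measures on a measurable space $(Z,\mathcal C)$ (with the topology of weak convergence when $Z$ is Polish); $B(Z,\mathcal C)$ is the set of bounded real $\mathcal C$-measurable functions. A Markov transition kernel from $(Z,\mathcal C)$ to $(W,\mathcal D)$ is a map $Q\colon W\times\mathcal C\to[0,1]$ such that $Q^w:=Q(w,\cdot)$ is a probability measure on $\mathcal C$ for each $w\in W$ and $w\mapsto Q(w,A)$ is $\mathcal D$-measurable for each $A\in\mathcal C$; a Markov kernel on $(Z,\mathcal C)$ is the case $(W,\mathcal D)=(Z,\mathcal C)$. Write $Q(f)(w)=\int f\,dQ^w$ and, for a probability measure $\mu$ on $(W,\mathcal D)$, $Q(\mu)(A)=\int_W Q(w,A)\,d\mu(w)$; for a Markov kernel, $\mu$ is $Q$-invariant if $Q(\mu)=\mu$. Ergodic decomposable simplexes. Let $\mathcal C$ be countably generated. A Markov kernel $Q$ on $(Z,\mathcal C)$ is a decomposition for $(\mathcal C,\mathcal C^0,M)$, where $\mathcal C^0\subseteq\mathcal C$ is a $\sigma$-subalgebra and $M\subseteq\mathcal P(Z)$, if $Q(f)$ is a version of $\mathbb E_\mu(f|\mathcal C^0)$ for all $f\in B(Z,\mathcal C)$, $\mu\in M$ (in particular $Q(f)$ is $\mathcal C^0$-measurable). $\mathcal C^0$ is $H$-sufficient for $M$ if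 such a $Q$ exists and $\mu(\{x:Q^x\in M\})=1$ for all $\mu\in M$. $M$ is separable if there is a countable subfamily of $\mathcal C$ on which any two distinct elements of $M$ differ. A separable $M$ is an ergodic decomposable simplex if there is a Markov kernel $Q$ with $Q^x(\{y:Q^y=Q^x\})=1$ for all $x\in Z$ (equivalently $Q(gQ(f))=Q(g)Q(f)$ for all $f,g\in B(Z,\mathcal C)$) such that $M$ is the set of all $Q$-invariant probability measures. Its $H$-sufficient $\sigma$-algebra $\mathcal C^0$ is the $\sigma$-algebra of $Q$-invariant sets ($A$ with $Q(I_A)=I_A$), unique up to $M$-equivalence (two $\sigma$-subalgebras are $M$-equivalent if for each $\mu\in M$ every set of one agrees $\mu$-a.e. with a set of the other). $M$ carries the smallest $\sigma$-algebra making all $\mu\mapsto\int f\,d\mu$, $f\in B(Z,\mathcal C)$, measurable. The barycenter of a probability measure $\tilde\mu$ on $M$ is $\mathrm{bar}(\tilde\mu)(f)=\int_M\int f\,d\nu\,d\tilde\mu(\nu)$. The boundary $\partial_e(M)$ is the set of $m\in M$ such that the only probability measure on $M$ with barycenter $m$ is $\delta_m$. The associated Markov kernel $Q$ is always chosen so that it is a decomposition for $(\mathcal C,\mathcal C^0,M)$ and $\partial_e(M)=\{Q^x:x\in Z\}$. Linear restrictions. A linear restriction is a triple $R=(\Omega,M^X,M^Y)$ with $\Omega$ a set of real measurable functions on $X\times Y$ and nonempty $M^X\subseteq\mathcal P(X)$, $M^Y\subseteq\mathcal P(Y)$. With $\mathrm{Pr}_X,\mathrm{Pr}_Y$ the marginal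 maps, $\Pi_R(X\times Y)$ is the set of $\pi\in\mathcal P(X\times Y)$ with $\int\omega\,d\pi=0$ for all $\omega\in\Omega$, $\mathrm{Pr}_X(\pi)\in M^X$, $\mathrm{Pr}_Y(\pi)\in M^Y$; and $\Pi_R(\mu,\nu)=\{\pi\in\Pi_R(X\times Y):\mathrm{Pr}_X(\pi)=\mu,\mathrm{Pr}_Y(\pi)=\nu\}$. $R$ is weakly regular if $M^X,M^Y$ are weakly closed; for each $\omega\in\Omega$ the functional $\pi\mapsto\int\omega\,d\pi$ is weakly continuous on $\{\pi\in\mathcal P(X\times Y):\mathrm{Pr}_X(\pi)\in M^X,\mathrm{Pr}_Y(\pi)\in M^Y\}$; and $\Pi_R(\mu,\nu)\ne\emptyset$ for all $\mu\in M^X,\nu\in M^Y$. $R$ is ergodic decomposable (with $M^X,M^Y$ ergodic decomposable simplexes) if there is an ergodic decomposable simplex $M\subseteq\mathcal P(X\times Y)$ with $H$-sufficient $\sigma$-algebra $(\mathcal A\otimes\mathcal B)^0\subseteq\mathcal A\otimes\mathcal B$ such that $\Pi_R(X\times Y)\subseteq M$, $\mathcal A^0\otimes\mathcal B^0\subseteq(\mathcal A\otimes\mathcal B)^0$, and $\mathrm{Pr}_X(\gamma)\in\partial_e(M^X)$, $\mathrm{Pr}_Y(\gamma)\in\partial_e(M^Y)$ for all $\gamma\in\partial_e(M)$. $R$ is coherent for $M$ if $\pi\in\Pi_R(X\times Y)$ implies $\int_S\omega\,d\pi=0$ for all $\omega\in\Omega$, $S\in(\mathcal A\otimes\mathcal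 B)^0$. Further sets. $\tilde\Pi(\tilde\mu,\tilde\nu)$ is the set of probability measures $\tilde\pi$ on $(X\times Y,(\mathcal A\otimes\mathcal B)^0)$ with marginals $\tilde\mu$ on $\mathcal A^0$ and $\tilde\nu$ on $\mathcal B^0$. $\Theta(R,\mu,\nu)$ is the set of pairs $(\pi,Q_\pi)$ where $\pi\in\Pi_R(\mu,\nu)$ and $Q_\pi$ is a Markov transition kernel from $(X\times Y,\mathcal A\otimes\mathcal B)$ to $(X\times Y,(\mathcal A\otimes\mathcal B)^0)$ with $Q_\pi(\tilde\pi)=\pi$ and $Q_\pi^{(x,y)}\in\Pi_R(Q_X^x,Q_Y^y)$ for $\tilde\pi$-a.e. $(x,y)$, where $\tilde\pi$ is the restriction of $\pi$ to $(\mathcal A\otimes\mathcal B)^0$. Optimal kernel. $Q_{opt}$ denotes a Markov transition kernel from $(X\times Y,\mathcal A\otimes\mathcal B)$ to $(X\times Y,(\mathcal A\otimes\mathcal B)^0)$ such that (1) $\int c\,dQ_{opt}^{(x,y)}=\inf\{\int c\,d\pi:\pi\in\Pi_R(\xi(x),\eta(y))\}$ for all $(x,y)$; (2) for every $(\pi,Q_\pi)\in\Theta(R,\mu,\nu)$, $\int c\,dQ_{opt}(\tilde\pi)\le\int c\,dQ_\pi(\tilde\pi)$ with $\tilde\pi$ the restriction of $\pi$ to $(\mathcal A\otimes\mathcal B)^0$; (3) for every $\tilde\pi\in\tilde\Pi(\tilde\mu,\tilde\nu)$, $(Q_{opt}(\tilde\pi),Q_{opt})\in\Theta(R,\mu,\nu)$.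 *)

theory Defs
  imports "HOL-Probability.Probability"
begin

text \<open>
  A measurable space \<open>(Z, \<C>)\<close> is represented by a measure \<open>Z\<close> of which only \<open>space Z\<close> and
  \<open>sets Z\<close> matter; a sub-sigma-algebra is a measure \<open>C0\<close> with \<open>subalgebra Z C0\<close>.
  \<open>space (prob_algebra Z)\<close> is the set of probability measures on \<open>Z\<close>, and
  \<open>Q \<in> W \<rightarrow>\<^sub>M prob_algebra Z\<close> says that \<open>Q\<close> is a Markov transition kernel from \<open>Z\<close> to \<open>W\<close>
  (the measure on \<open>Z\<close> depends measurably on the point of \<open>W\<close>); \<open>bind p Q\<close> is then \<open>Q(p)\<close>.
  The product sigma-algebra on a product of Polish spaces is \<open>borel\<close>, see \<open>borel_prod\<close>.
\<close>

section \<open>Kernels and ergodic decomposable simplexes\<close>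

definition bounded_measurable :: "'a measure \<Rightarrow> ('a \<Rightarrow> real) set" where
  "bounded_measurable Z = {f \<in> borel_measurable Z. bounded (f ` space Z)}"

definition is_decomposition ::
  "'a measure \<Rightarrow> 'a measure \<Rightarrow> 'a measure set \<Rightarrow> ('a \<Rightarrow> 'a measure) \<Rightarrow> bool" where
  "is_decomposition Z C0 M Q \<longleftrightarrow>
     Q \<in> Z \<rightarrow>\<^sub>M prob_algebra Z \<and>
     (\<forall>f\<in>bounded_measurable Z.
        (\<lambda>x. \<integral>y. f y \<partial>Q x) \<in> borel_measurable C0 \<and>
        (\<forall>\<mu>\<in>M. AE x in \<mu>. (\<integral>y. f y \<partial>Q x) = real_cond_exp \<mu> C0 f x))"

definition H_sufficient :: "'a measure \<Rightarrow> 'a measure \<Rightarrow> 'a measure set \<Rightarrow> bool" where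
  "H_sufficient Z C0 M \<longleftrightarrow>
     subalgebra Z C0 \<and>
     (\<exists>Q. is_decomposition Z C0 M Q \<and> (\<forall>\<mu>\<in>M. measure \<mu> {x \<in> space Z. Q x \<in> M} = 1))"

definition separable_measures :: "'a measure \<Rightarrow> 'a measure set \<Rightarrow> bool" where
  "separable_measures Z M \<longleftrightarrow>
     (\<exists>D\<subseteq>sets Z. countable D \<and>
        (\<forall>\<mu>\<in>M. \<forall>\<nu>\<in>M. \<mu> \<noteq> \<nu> \<longrightarrow> (\<exists>A\<in>D. measure \<mu> A \<noteq> measure \<nu> A)))"

definition invariant_probs :: "'a measure \<Rightarrow> ('a \<Rightarrow> 'a measure) \<Rightarrow> 'a measure set" where
  "invariant_probs Z Q = {\<mu> \<in> space (prob_algebra Z). bind \<mu> Q = \<mu>}"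

definition ergodic_kernel :: "'a measure \<Rightarrow> 'a measure set \<Rightarrow> ('a \<Rightarrow> 'a measure) \<Rightarrow> bool" where
  "ergodic_kernel Z M Q \<longleftrightarrow>
     Q \<in> Z \<rightarrow>\<^sub>M prob_algebra Z \<and>
     (\<forall>x\<in>space Z. measure (Q x) {y \<in> space Z. Q y = Q x} = 1) \<and>
     M = invariant_probs Z Q"

definition ergodic_decomposable_simplex :: "'a measure \<Rightarrow> 'a measure set \<Rightarrow> bool" where
  "ergodic_decomposable_simplex Z M \<longleftrightarrow> separable_measures Z M \<and> (\<exists>Q. ergodic_kernel Z M Q)"

definition invariant_algebra :: "'a measure \<Rightarrow> ('a \<Rightarrow> 'a measure) \<Rightarrow> 'a measure" where
  "invariant_algebra Z Q =
     sigma (space Z) {A \<in> sets Z. \<forall>x\<in>space Z. (\<integral>y. indicator A y \<partial>Q x) = (indicator A x :: real)}"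

definition M_equivalent :: "'a measure set \<Rightarrow> 'a measure \<Rightarrow> 'a measure \<Rightarrow> bool" where
  "M_equivalent M F G \<longleftrightarrow>
     (\<forall>\<mu>\<in>M.
        (\<forall>A\<in>sets F. \<exists>B\<in>sets G. AE x in \<mu>. x \<in> A \<longleftrightarrow> x \<in> B) \<and>
        (\<forall>B\<in>sets G. \<exists>A\<in>sets F. AE x in \<mu>. x \<in> A \<longleftrightarrow> x \<in> B))"

text \<open>
  The sigma-algebra of \<open>prob_algebra Z\<close> is the smallest one making all evaluations
  \<open>\<mu> \<mapsto> \<mu>(A)\<close>, equivalently all \<open>\<mu> \<mapsto> \<integral>f d\<mu>\<close> with \<open>f\<close> bounded measurable, measurable.
\<close>

definition measures_on :: "'a measure \<Rightarrow> 'a measure set \<Rightarrow> 'a measure measure" where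
  "measures_on Z M = restrict_space (prob_algebra Z) M"

definition has_barycenter :: "'a measure \<Rightarrow> 'a measure measure \<Rightarrow> 'a measure \<Rightarrow> bool" where
  "has_barycenter Z p m \<longleftrightarrow>
     m \<in> space (prob_algebra Z) \<and>
     (\<forall>f\<in>bounded_measurable Z. (\<integral>x. f x \<partial>m) = (\<integral>\<nu>. (\<integral>x. f x \<partial>\<nu>) \<partial>p))"

definition extreme_boundary :: "'a measure \<Rightarrow> 'a measure set \<Rightarrow> 'a measure set" where
  "extreme_boundary Z M =
     {m \<in> M. {p \<in> space (prob_algebra (measures_on Z M)). has_barycenter Z p m}
              = {return (measures_on Z M) m}}"

text \<open>
  The H-sufficient sigma-algebra of an ergodic decomposable simplex is the algebra of
  \<open>Q\<close>-invariant sets and is determined only up to \<open>M\<close>-equivalence; \<open>C0\<close> may be any version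
  for which the associated kernel \<open>Q\<close> is a decomposition.  The algebra of \<open>Q\<close>-invariant sets
  itself is one admissible choice.
\<close>

definition simplex_with ::
  "'a measure \<Rightarrow> 'a measure set \<Rightarrow> 'a measure \<Rightarrow> ('a \<Rightarrow> 'a measure) \<Rightarrow> bool" where
  "simplex_with Z M C0 Q \<longleftrightarrow>
     ergodic_decomposable_simplex Z M \<and>
     ergodic_kernel Z M Q \<and>
     H_sufficient Z C0 M \<and>
     M_equivalent M C0 (invariant_algebra Z Q) \<and>
     is_decomposition Z C0 M Q \<and>
     extreme_boundary Z M = Q ` space Z"

section \<open>Weak topology and extended integrals\<close>

definition weak_topology :: "'a::topological_space measure topology" where
  "weak_topology = topology_generated_by
     {{\<mu> \<in> space (prob_algebra borel). (\<integral>x. f x \<partial>\<mu>) \<in> U} | (f :: 'a \<Rightarrow> real) U.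
        continuous_on UNIV f \<and> bounded (range f) \<and> open U}"

lemma topspace_weak_topology: "topspace weak_topology = space (prob_algebra borel)"
proof -
  have "\<exists>(f :: 'a \<Rightarrow> real) U. space (prob_algebra (borel :: 'a measure)) =
      {\<mu> \<in> space (prob_algebra borel). (\<integral>x. f x \<partial>\<mu>) \<in> U} \<and>
      continuous_on UNIV f \<and> bounded (range f) \<and> open U"
    by (rule exI[of _ "\<lambda>_. 0"], rule exI[of _ UNIV]) auto
  then show ?thesis
    unfolding weak_topology_def topology_generated_by_topspace by blast
qed

definition lower_semicontinuous :: "'a topology \<Rightarrow> ('a \<Rightarrow> ereal) \<Rightarrow> bool" where
  "lower_semicontinuous T f \<longleftrightarrow> (\<forall>t. openin T {x \<in> topspace T. t < f x})"

text \<open>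
  Integral with values in the extended reals; it is meaningful when the negative part
  has finite integral.
\<close>

definition ext_integral :: "'a measure \<Rightarrow> ('a \<Rightarrow> ereal) \<Rightarrow> ereal" where
  "ext_integral p f =
     enn2ereal (\<integral>\<^sup>+x. e2ennreal (f x) \<partial>p) - enn2ereal (\<integral>\<^sup>+x. e2ennreal (- f x) \<partial>p)"

definition Cost :: "('a \<Rightarrow> real) \<Rightarrow> 'a measure \<Rightarrow> ereal" where
  "Cost c p = ext_integral p (\<lambda>z. ereal (c z))"

text \<open>
  The integral of \<open>c\<close> exists in the half-open interval from \<open>-\<infinity>\<close> (excluded) to \<open>\<infinity>\<close>
  (included) for every probability measure.
\<close>

definition Cost_well_defined :: "('a::topological_space \<Rightarrow> real) \<Rightarrow> bool" where
  "Cost_well_defined c \<longleftrightarrow>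
     (\<forall>p\<in>space (prob_algebra borel). (\<integral>\<^sup>+z. ennreal (- c z) \<partial>p) < \<infinity>)"

section \<open>Linear restrictions\<close>

definition linear_restriction ::
  "('a::polish_space \<times> 'b::polish_space \<Rightarrow> real) set \<Rightarrow> 'a measure set \<Rightarrow> 'b measure set \<Rightarrow> bool" where
  "linear_restriction \<Omega> MX MY \<longleftrightarrow>
     \<Omega> \<subseteq> borel_measurable borel \<and>
     MX \<subseteq> space (prob_algebra borel) \<and> MX \<noteq> {} \<and>
     MY \<subseteq> space (prob_algebra borel) \<and> MY \<noteq> {}"

definition with_marginals_in ::
  "'a::polish_space measure set \<Rightarrow> 'b::polish_space measure set \<Rightarrow> ('a \<times> 'b) measure set" where
  "with_marginals_in MX MY =
     {\<pi> \<in> space (prob_algebra borel). distr \<pi> borel fst \<in> MX \<and> distr \<pi> borel snd \<in> MY}"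

text \<open>
  The integrability requirement is explicit because the Bochner integral of a
  non-integrable function is \<open>0\<close> by convention.
\<close>

definition restricted_probs ::
  "('a::polish_space \<times> 'b::polish_space \<Rightarrow> real) set \<Rightarrow> 'a measure set \<Rightarrow> 'b measure set
    \<Rightarrow> ('a \<times> 'b) measure set" where
  "restricted_probs \<Omega> MX MY =
     {\<pi> \<in> with_marginals_in MX MY. \<forall>\<omega>\<in>\<Omega>. integrable \<pi> \<omega> \<and> (\<integral>z. \<omega> z \<partial>\<pi>) = 0}"

definition restricted_plans ::
  "('a::polish_space \<times> 'b::polish_space \<Rightarrow> real) set \<Rightarrow> 'a measure set \<Rightarrow> 'b measure set
    \<Rightarrow> 'a measure \<Rightarrow> 'b measure \<Rightarrow> ('a \<times> 'b) measure set" where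
  "restricted_plans \<Omega> MX MY \<mu> \<nu> =
     {\<pi> \<in> restricted_probs \<Omega> MX MY. distr \<pi> borel fst = \<mu> \<and> distr \<pi> borel snd = \<nu>}"

definition weakly_regular ::
  "('a::polish_space \<times> 'b::polish_space \<Rightarrow> real) set \<Rightarrow> 'a measure set \<Rightarrow> 'b measure set \<Rightarrow> bool" where
  "weakly_regular \<Omega> MX MY \<longleftrightarrow>
     closedin weak_topology MX \<and> closedin weak_topology MY \<and>
     (\<forall>\<omega>\<in>\<Omega>.
        (\<forall>\<pi>\<in>with_marginals_in MX MY. integrable \<pi> \<omega>) \<and>
        continuous_map (subtopology weak_topology (with_marginals_in MX MY)) euclideanreal
          (\<lambda>\<pi>. \<integral>z. \<omega> z \<partial>\<pi>)) \<and>
     (\<forall>\<mu>\<in>MX. \<forall>\<nu>\<in>MY. restricted_plans \<Omega> MX MY \<mu> \<nu> \<noteq> {})"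

definition ergodic_decomposable_with ::
  "('a::polish_space \<times> 'b::polish_space \<Rightarrow> real) set \<Rightarrow> 'a measure set \<Rightarrow> 'b measure set
    \<Rightarrow> 'a measure \<Rightarrow> 'b measure
    \<Rightarrow> ('a \<times> 'b) measure set \<Rightarrow> ('a \<times> 'b) measure \<Rightarrow> ('a \<times> 'b \<Rightarrow> ('a \<times> 'b) measure) \<Rightarrow> bool" where
  "ergodic_decomposable_with \<Omega> MX MY A0 B0 M AB0 QM \<longleftrightarrow>
     simplex_with borel M AB0 QM \<and>
     restricted_probs \<Omega> MX MY \<subseteq> M \<and>
     sets (A0 \<Otimes>\<^sub>M B0) \<subseteq> sets AB0 \<and>
     (\<forall>\<gamma>\<in>extreme_boundary borel M.
        distr \<gamma> borel fst \<in> extreme_boundary borel MX \<and>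
        distr \<gamma> borel snd \<in> extreme_boundary borel MY)"

definition coherent ::
  "('a::polish_space \<times> 'b::polish_space \<Rightarrow> real) set \<Rightarrow> 'a measure set \<Rightarrow> 'b measure set
    \<Rightarrow> ('a \<times> 'b) measure \<Rightarrow> bool" where
  "coherent \<Omega> MX MY AB0 \<longleftrightarrow>
     (\<forall>\<pi>\<in>restricted_probs \<Omega> MX MY. \<forall>\<omega>\<in>\<Omega>. \<forall>S\<in>sets AB0. (LINT z:S|\<pi>. \<omega> z) = 0)"

section \<open>Plans on the invariant algebras and optimal kernels\<close>

definition tilde_plans ::
  "'a measure \<Rightarrow> 'b measure \<Rightarrow> ('a \<times> 'b) measure \<Rightarrow> 'a measure \<Rightarrow> 'b measure
    \<Rightarrow> ('a \<times> 'b) measure set" where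
  "tilde_plans A0 B0 AB0 \<mu>t \<nu>t =
     {p \<in> space (prob_algebra AB0). distr p A0 fst = \<mu>t \<and> distr p B0 snd = \<nu>t}"

definition Theta ::
  "('a::polish_space \<times> 'b::polish_space \<Rightarrow> real) set \<Rightarrow> 'a measure set \<Rightarrow> 'b measure set
    \<Rightarrow> ('a \<Rightarrow> 'a measure) \<Rightarrow> ('b \<Rightarrow> 'b measure) \<Rightarrow> ('a \<times> 'b) measure \<Rightarrow> 'a measure \<Rightarrow> 'b measure
    \<Rightarrow> (('a \<times> 'b) measure \<times> ('a \<times> 'b \<Rightarrow> ('a \<times> 'b) measure)) set" where
  "Theta \<Omega> MX MY QX QY AB0 \<mu> \<nu> =
     {(\<pi>, Q). \<pi> \<in> restricted_plans \<Omega> MX MY \<mu> \<nu> \<and>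
        Q \<in> AB0 \<rightarrow>\<^sub>M prob_algebra borel \<and>
        bind (restr_to_subalg \<pi> AB0) Q = \<pi> \<and>
        (AE (x, y) in restr_to_subalg \<pi> AB0. Q (x, y) \<in> restricted_plans \<Omega> MX MY (QX x) (QY y))}"

definition optimal_kernel ::
  "('a::polish_space \<times> 'b::polish_space \<Rightarrow> real) \<Rightarrow> ('a \<times> 'b \<Rightarrow> real) set
    \<Rightarrow> 'a measure set \<Rightarrow> 'b measure set \<Rightarrow> 'a measure \<Rightarrow> 'b measure
    \<Rightarrow> ('a \<Rightarrow> 'a measure) \<Rightarrow> ('b \<Rightarrow> 'b measure) \<Rightarrow> ('a \<times> 'b) measure \<Rightarrow> 'a measure \<Rightarrow> 'b measure
    \<Rightarrow> ('a \<times> 'b \<Rightarrow> ('a \<times> 'b) measure) \<Rightarrow> bool" where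
  "optimal_kernel c \<Omega> MX MY A0 B0 QX QY AB0 \<mu> \<nu> Qopt \<longleftrightarrow>
     Qopt \<in> AB0 \<rightarrow>\<^sub>M prob_algebra borel \<and>
     (\<forall>x y. Cost c (Qopt (x, y)) = (INF \<pi>\<in>restricted_plans \<Omega> MX MY (QX x) (QY y). Cost c \<pi>)) \<and>
     (\<forall>(\<pi>, Q)\<in>Theta \<Omega> MX MY QX QY AB0 \<mu> \<nu>.
        Cost c (bind (restr_to_subalg \<pi> AB0) Qopt) \<le> Cost c (bind (restr_to_subalg \<pi> AB0) Q)) \<and>
     (\<forall>p\<in>tilde_plans A0 B0 AB0 (restr_to_subalg \<mu> A0) (restr_to_subalg \<nu> B0).
        (bind p Qopt, Qopt) \<in> Theta \<Omega> MX MY QX QY AB0 \<mu> \<nu>)"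

end

theory Submission
  imports Defs
begin

text \<open>
  Mixing \<open>Qopt\<close> over a tilde plan gives a plan of the same cost, hence one inequality.
  For the other one, every plan \<open>\<pi>\<close> is disintegrated along \<open>AB0\<close> by the kernel \<open>QM\<close> itself:
  the pair \<open>(\<pi>, QM)\<close> lies in \<open>Theta\<close>, so that optimality applies to it.  The marginals of
  \<open>QM (x, y)\<close> are \<open>QX x\<close> and \<open>QY y\<close> because \<open>A0\<close> and \<open>B0\<close> sit inside \<open>AB0\<close>, and the linear
  constraints hold by coherence.  Each constraint holds only almost everywhere, and \<open>\<Omega>\<close> may be
  uncountable; since the weak topology is hereditarily Lindelof, countably many
  constraints imply all the others.
\<close>

section \<open>The weak topology is hereditarily Lindelof\<close>

definition step_sup :: "(rat \<times> 'a set) set \<Rightarrow> 'a \<Rightarrow> ennreal" where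
  "step_sup F z = (SUP (q, V)\<in>F. ennreal (of_rat q) * indicator V z)"

lemma step_sup_measurable:
  assumes "finite F" "\<And>q V. (q, V) \<in> F \<Longrightarrow> V \<in> sets M"
  shows "step_sup F \<in> borel_measurable M"
proof -
  have "(\<lambda>z. SUP p\<in>F. ennreal (of_rat (fst p)) * indicator (snd p) z) \<in> borel_measurable M"
    using assms by (intro borel_measurable_SUP countable_finite) auto
  then show ?thesis
    by (simp add: step_sup_def[abs_def] case_prod_beta)
qed

lemma step_sup_mono: "F \<subseteq> G \<Longrightarrow> step_sup F z \<le> step_sup G z"
  unfolding step_sup_def by (rule SUP_subset_mono) auto

lemma step_sup_UN: "step_sup (\<Union>n. F n) z = (SUP n. step_sup (F n) z)"
  unfolding step_sup_def by (rule SUP_UNION)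

text \<open>Below \<open>f z\<close> lies a rational \<open>q\<close>, and the open set where
  \<open>f\<close> exceeds \<open>q\<close> contains a basic neighbourhood of \<open>z\<close>.
  Using only rational levels and basic sets keeps the family countable when \<open>B\<close> is.
  Negative levels are clipped to 0 by \<open>ennreal\<close>, which is harmless since
  \<open>f\<close> is nonnegative.\<close>

lemma step_sup_eq_continuous:
  fixes f :: "'a::topological_space \<Rightarrow> real"
  assumes B: "topological_basis B" and f: "continuous_on UNIV f" "\<And>z. 0 \<le> f z"
  shows "step_sup {(q, V). V \<in> B \<and> (\<forall>z\<in>V. of_rat q \<le> f z)} z = ennreal (f z)"
    (is "step_sup ?S z = _")
proof (rule antisym)
  show "step_sup ?S z \<le> ennreal (f z)"
    unfolding step_sup_def
    by (intro SUP_least) (auto simp: indicator_def intro!: ennreal_leI)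
  show "ennreal (f z) \<le> step_sup ?S z"
  proof (rule dense_le)
    fix a :: ennreal assume a: "a < ennreal (f z)"
    then obtain r where r: "a = ennreal r" "0 \<le> r"
      by (cases a) auto
    with a f(2)[of z] have "r < f z"
      by (simp add: ennreal_less_iff)
    then obtain q where q: "r < of_rat q" "of_rat q < f z"
      using of_rat_dense by blast
    have "open {y. of_rat q < f y}"
      using open_Collect_less[OF continuous_on_const f(1)] .
    with q B obtain V where V: "V \<in> B" "z \<in> V" "V \<subseteq> {y. of_rat q < f y}"
      by (metis mem_Collect_eq topological_basisE)
    then have "{(q, V)} \<subseteq> ?S"
      by (auto simp: less_imp_le)
    then have "step_sup {(q, V)} z \<le> step_sup ?S z"
      by (rule step_sup_mono)
    moreover have "a \<le> step_sup {(q, V)} z"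
      using V q r by (simp add: step_sup_def ennreal_leI)
    ultimately show "a \<le> step_sup ?S z"
      by order
  qed
qed

text \<open>The members of \<open>K\<close> need not be open. The covering argument below relies
  only on the countability of \<open>K\<close>, so no semicontinuity of integrals has to be
  established for them.\<close>

definition union_generated :: "'a set set \<Rightarrow> 'a set \<Rightarrow> bool" where
  "union_generated K S \<longleftrightarrow> (\<forall>x\<in>S. \<exists>T\<in>K. x \<in> T \<and> T \<subseteq> S)"

lemma union_generated_Int:
  assumes "\<And>S T. S \<in> K \<Longrightarrow> T \<in> K \<Longrightarrow> S \<inter> T \<in> K" "union_generated K S" "union_generated K T"
  shows "union_generated K (S \<inter> T)"
  unfolding union_generated_def
proof
  fix x assume "x \<in> S \<inter> T"
  then obtain U V where "U \<in> K" "x \<in> U" "U \<subseteq> S" "V \<in> K" "x \<in> V" "V \<subseteq> T"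
    using assms(2,3) unfolding union_generated_def by (meson IntE)
  then show "\<exists>W\<in>K. x \<in> W \<and> W \<subseteq> S \<inter> T"
    using assms(1) by (intro bexI[of _ "U \<inter> V"]) auto
qed

lemma union_generated_Union:
  assumes "\<And>S. S \<in> C \<Longrightarrow> union_generated K S"
  shows "union_generated K (\<Union>C)"
  using assms unfolding union_generated_def by (meson Sup_upper UnionE order_trans)

lemma union_generated_mono: "K \<subseteq> L \<Longrightarrow> union_generated K S \<Longrightarrow> union_generated L S"
  unfolding union_generated_def by blast

text \<open>After a shift that makes \<open>f\<close> nonnegative, monotone convergence shows that a
  finite step supremum below the shifted function already has an integral above the shifted
  \<open>t\<close>. A rational lower bound on that integral defines a member of \<open>K\<close>,
  and it forces the bound on \<open>f\<close> for every measure in that member. For countable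
  \<open>B\<close> the index set of \<open>K\<close> is countable.\<close>

lemma integral_superlevel_union_generated:
  fixes B :: "'a::topological_space set set" and f :: "'a \<Rightarrow> real"
  assumes B: "countable B" "topological_basis B"
    and f: "continuous_on UNIV f" "bounded (range f)"
  defines "K \<equiv> (\<lambda>(F, a). {\<gamma> \<in> space (prob_algebra borel). ennreal (of_rat a) < (\<integral>\<^sup>+z. step_sup F z \<partial>\<gamma>)}) `
      ({F. finite F \<and> F \<subseteq> UNIV \<times> B} \<times> {0..})"
  shows "union_generated K {\<gamma> \<in> space (prob_algebra borel). t < (\<integral>z. f z \<partial>\<gamma>)}"
  unfolding union_generated_def
proof
  fix \<gamma> assume "\<gamma> \<in> {\<gamma> \<in> space (prob_algebra borel). t < (\<integral>z. f z \<partial>\<gamma>)}"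
  then have \<gamma>: "\<gamma> \<in> space (prob_algebra borel)" and t: "t < (\<integral>z. f z \<partial>\<gamma>)"
    by auto
  obtain b where b: "\<And>z. \<bar>f z\<bar> \<le> b"
    using f(2) by (auto simp: bounded_iff)
  \<comment> \<open>The shift makes both \<open>g\<close> and \<open>t + C\<close> nonnegative, so
    that comparisons can be moved to \<open>ennreal\<close> without loss.\<close>
  define C where "C = \<bar>t\<bar> + b"
  define g where "g z = f z + C" for z
  have g0: "0 \<le> g z" for z
    using b[of z] by (auto simp: g_def C_def)
  have tC: "0 \<le> t + C"
    \<comment> \<open>The bound at an arbitrary point shows that \<open>b\<close> is
      nonnegative.\<close>
    using b[of undefined] by (auto simp: C_def)
  have gc: "continuous_on UNIV g"
    unfolding g_def by (intro continuous_intros f)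
  have int_g: "(\<integral>\<^sup>+z. ennreal (g z) \<partial>\<sigma>) = ennreal ((\<integral>z. f z \<partial>\<sigma>) + C)" "0 \<le> (\<integral>z. f z \<partial>\<sigma>) + C"
    if "\<sigma> \<in> space (prob_algebra borel)" for \<sigma>
  proof -
    have s: "sets \<sigma> = sets borel" and "prob_space \<sigma>"
      using that by (auto simp: space_prob_algebra)
    interpret prob_space \<sigma> by fact
    have "f \<in> borel_measurable \<sigma>"
      using borel_measurable_continuous_onI[OF f(1)] s by (simp cong: measurable_cong_sets)
    then have i: "integrable \<sigma> f"
      using b by (intro integrable_const_bound[where B=b]) auto
    have eq: "(\<integral>z. g z \<partial>\<sigma>) = (\<integral>z. f z \<partial>\<sigma>) + C"
      unfolding g_def using i by (simp add: prob_space)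
    have "integrable \<sigma> g"
      unfolding g_def using i by simp
    then show "(\<integral>\<^sup>+z. ennreal (g z) \<partial>\<sigma>) = ennreal ((\<integral>z. f z \<partial>\<sigma>) + C)"
      using g0 by (simp add: nn_integral_eq_integral eq)
    show "0 \<le> (\<integral>z. f z \<partial>\<sigma>) + C"
      unfolding eq[symmetric] using g0 by (intro integral_nonneg_AE) auto
  qed
  define S where "S = {(q, V). V \<in> B \<and> (\<forall>z\<in>V. of_rat q \<le> g z)}"
  have "countable S"
    by (rule countable_subset[of _ "UNIV \<times> B"]) (auto simp: S_def B)
  have S_sub: "S \<subseteq> UNIV \<times> B"
    by (auto simp: S_def)
  \<comment> \<open>The countable family \<open>S\<close> is exhausted by an increasing sequence of
    finite subfamilies, as monotone convergence and membership in \<open>K\<close> require.\<close>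
  define G where "G n = {p \<in> S. to_nat_on S p \<le> n}" for n
  have G: "finite (G n)" "G n \<subseteq> S" for n
  proof -
    have "finite (to_nat_on S -` {..n} \<inter> S)"
      using \<open>countable S\<close> by (intro finite_vimage_IntI) auto
    then show "finite (G n)"
      by (rule rev_finite_subset) (auto simp: G_def)
  qed (auto simp: G_def)
  have UN_G: "(\<Union>n. G n) = S"
    by (auto simp: G_def)
  have g_SUP: "ennreal (g z) = (SUP n. step_sup (G n) z)" for z
    using step_sup_eq_continuous[OF B(2) gc g0, folded S_def] by (simp add: UN_G flip: step_sup_UN)
  have meas: "step_sup (G n) \<in> borel_measurable \<gamma>" for n
  proof (rule step_sup_measurable[OF G(1)])
    fix q V assume "(q, V) \<in> G n"
    then have "open V"
      using G(2) B(2) S_sub by (auto intro: topological_basis_open)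
    then show "V \<in> sets \<gamma>"
      using \<gamma> by (simp add: space_prob_algebra)
  qed
  have inc: "incseq (\<lambda>n. step_sup (G n))"
    by (intro incseq_SucI le_funI step_sup_mono) (auto simp: G_def)
  have "(\<integral>\<^sup>+z. ennreal (g z) \<partial>\<gamma>) = (SUP n. \<integral>\<^sup>+z. step_sup (G n) z \<partial>\<gamma>)"
    unfolding g_SUP by (rule nn_integral_monotone_convergence_SUP[OF inc meas])
  moreover have "ennreal (t + C) < (\<integral>\<^sup>+z. ennreal (g z) \<partial>\<gamma>)"
    using t tC by (simp add: int_g[OF \<gamma>] ennreal_less_iff)
  ultimately obtain n where n: "ennreal (t + C) < (\<integral>\<^sup>+z. step_sup (G n) z \<partial>\<gamma>)"
    by (auto simp: less_SUP_iff)
  \<comment> \<open>A value strictly below another one is finite. The real \<open>r\<close> thus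
    leaves room for a rational \<open>a\<close> without any claim that the integral of the step
    supremum is finite.\<close>
  obtain b' where b': "ennreal (t + C) < b'" "b' < (\<integral>\<^sup>+z. step_sup (G n) z \<partial>\<gamma>)"
    using dense[OF n] by blast
  then obtain r where "b' = ennreal r" "0 \<le> r"
    by (cases b') auto
  with b' have r: "t + C < r" "ennreal r < (\<integral>\<^sup>+z. step_sup (G n) z \<partial>\<gamma>)"
    using tC by (auto simp: ennreal_less_iff)
  obtain a where a: "t + C < of_rat a" "of_rat a < r"
    using of_rat_dense r(1) by blast
  define T where "T = {\<sigma> \<in> space (prob_algebra borel). ennreal (of_rat a) < (\<integral>\<^sup>+z. step_sup (G n) z \<partial>\<sigma>)}"
  have "0 \<le> (of_rat a :: real)"
    using a tC by linarith
  then have "T \<in> K"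
    unfolding K_def T_def using G S_sub
    by (intro image_eqI[of _ _ "(G n, a)"]) (auto simp: zero_le_of_rat_iff)
  moreover have "\<gamma> \<in> T"
    using \<gamma> r(2) a unfolding T_def
    by (auto intro: le_less_trans[OF ennreal_leI[of "of_rat a" r]])
  moreover have "t < (\<integral>z. f z \<partial>\<sigma>)" if "\<sigma> \<in> T" for \<sigma>
  proof -
    have \<sigma>: "\<sigma> \<in> space (prob_algebra borel)" "ennreal (of_rat a) < (\<integral>\<^sup>+z. step_sup (G n) z \<partial>\<sigma>)"
      using that by (auto simp: T_def)
    have "(\<integral>\<^sup>+z. step_sup (G n) z \<partial>\<sigma>) \<le> (\<integral>\<^sup>+z. ennreal (g z) \<partial>\<sigma>)"
      unfolding g_SUP by (intro nn_integral_mono SUP_upper) auto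
    with \<sigma> have "ennreal (of_rat a) < ennreal ((\<integral>z. f z \<partial>\<sigma>) + C)"
      using int_g(1)[OF \<sigma>(1)] by order
    then show ?thesis
      using a tC \<open>0 \<le> (of_rat a :: real)\<close> by (simp add: ennreal_less_iff)
  qed
  ultimately show "\<exists>T\<in>K. \<gamma> \<in> T \<and> T \<subseteq> {\<gamma> \<in> space (prob_algebra borel). t < (\<integral>z. f z \<partial>\<gamma>)}"
    by (intro bexI[of _ T]) (auto simp: T_def)
qed

text \<open>The subbasic open sets are built from superlevel sets of integrals, for which the
  previous lemma provides a countable family. Its finite intersections then serve every open set, by
  induction on the generation of the topology.\<close>

lemma weak_topology_countably_generated:
  "\<exists>K. countable K \<and>
     (\<forall>S. openin (weak_topology :: 'a::second_countable_topology measure topology) S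
        \<longrightarrow> union_generated K S)"
proof -
  obtain B :: "'a set set" where B: "countable B" "topological_basis B"
    using ex_countable_basis by blast
  define P :: "'a measure set" where "P = space (prob_algebra borel)"
  define K0 where "K0 = (\<lambda>(F, a). {\<gamma> \<in> P. ennreal (of_rat a) < (\<integral>\<^sup>+z. step_sup F z \<partial>\<gamma>)}) `
      ({F. finite F \<and> F \<subseteq> UNIV \<times> B} \<times> {0..})"
  \<comment> \<open>Closure under finite intersections serves the \<open>Int\<close> case of the
    induction as well as the two-sided bounds in \<open>subbasic\<close>.\<close>
  define K where "K = Inter ` {F. finite F \<and> F \<subseteq> insert P K0}"
  have "countable K0"
    unfolding K0_def
    by (intro countable_image countable_SIGMA countable_Collect_finite_subset B(1)) auto
  then have "countable K"
    unfolding K_def by (intro countable_image countable_Collect_finite_subset) auto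
  have K_Int: "S \<inter> T \<in> K" if "S \<in> K" "T \<in> K" for S T
  proof -
    from that obtain F G where "S = \<Inter>F" "T = \<Inter>G" "finite F" "finite G" "F \<subseteq> insert P K0" "G \<subseteq> insert P K0"
      unfolding K_def by blast
    then show ?thesis
      unfolding K_def by (intro image_eqI[of _ _ "F \<union> G"]) auto
  qed
  have "T \<in> K" if "T \<in> K0" for T
    unfolding K_def using that by (intro image_eqI[of _ _ "{T}"]) auto
  then have "K0 \<subseteq> K"
    by blast
  have level: "union_generated K {\<gamma> \<in> P. t < (\<integral>z. f z \<partial>\<gamma>)}"
    if "continuous_on UNIV f" "bounded (range f)" for t and f :: "'a \<Rightarrow> real"
    using integral_superlevel_union_generated[OF B that, of t] \<open>K0 \<subseteq> K\<close>
    unfolding P_def[symmetric] K0_def[symmetric] by (rule union_generated_mono[rotated])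
  have subbasic: "union_generated K {\<gamma> \<in> P. (\<integral>z. f z \<partial>\<gamma>) \<in> U}"
    if f: "continuous_on UNIV f" "bounded (range f)" and U: "open U" for U and f :: "'a \<Rightarrow> real"
  proof -
    define I where "I = {(s, t). {s<..<t} \<subseteq> U}"
    \<comment> \<open>\<open>U\<close> is a union of open intervals. The upper bound
      \<open>t\<close> is turned into a lower bound for the integral of \<open>- f\<close>, so that
      \<open>level\<close> covers both sides.\<close>
    have "{\<gamma> \<in> P. (\<integral>z. f z \<partial>\<gamma>) \<in> U} =
        (\<Union>(s, t)\<in>I. {\<gamma> \<in> P. s < (\<integral>z. f z \<partial>\<gamma>)} \<inter> {\<gamma> \<in> P. - t < (\<integral>z. - f z \<partial>\<gamma>)})"
    proof (intro equalityI subsetI)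
      fix \<gamma> assume \<gamma>: "\<gamma> \<in> {\<gamma> \<in> P. (\<integral>z. f z \<partial>\<gamma>) \<in> U}"
      then obtain e where "0 < e" "ball (\<integral>z. f z \<partial>\<gamma>) e \<subseteq> U"
        using U by (auto simp: open_contains_ball)
      then have "((\<integral>z. f z \<partial>\<gamma>) - e, (\<integral>z. f z \<partial>\<gamma>) + e) \<in> I"
        by (simp add: I_def ball_eq_greaterThanLessThan)
      then show "\<gamma> \<in> (\<Union>(s, t)\<in>I. {\<gamma> \<in> P. s < (\<integral>z. f z \<partial>\<gamma>)} \<inter> {\<gamma> \<in> P. - t < (\<integral>z. - f z \<partial>\<gamma>)})"
        using \<gamma> \<open>0 < e\<close> by (intro UN_I) auto
    qed (auto simp: I_def)
    moreover have "union_generated K ({\<gamma> \<in> P. s < (\<integral>z. f z \<partial>\<gamma>)} \<inter> {\<gamma> \<in> P. - t < (\<integral>z. - f z \<partial>\<gamma>)})" for s t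
      using f by (intro union_generated_Int level K_Int continuous_intros) (auto simp: bounded_iff)
    ultimately show ?thesis
      by (auto intro!: union_generated_Union)
  qed
  have "union_generated K S" if "openin weak_topology S" for S
  proof -
    from that have "generate_topology_on
        {{\<mu> \<in> P. (\<integral>x. f x \<partial>\<mu>) \<in> U} | (f :: 'a \<Rightarrow> real) U.
          continuous_on UNIV f \<and> bounded (range f) \<and> open U} S"
      unfolding weak_topology_def P_def by (rule openin_topology_generated_by)
    then show ?thesis
    proof induction
      case Empty
      show ?case by (simp add: union_generated_def)
    next
      case (Int S T)
      then show ?case by (intro union_generated_Int K_Int) auto
    next
      case (UN C)
      then show ?case by (intro union_generated_Union)
    next
      case (Basis S)
      then show ?case using subbasic by auto
    qed
  qed
  with \<open>countable K\<close> show ?thesis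
    by blast
qed

text \<open>For each of the countably many members of \<open>K\<close> that lie in some
  \<open>U i\<close>, one such index is chosen. These members already exhaust every
  \<open>U i\<close>, hence the chosen indices suffice. The sets \<open>U i\<close> need not cover
  the whole space.\<close>

lemma weak_topology_hereditarily_Lindelof:
  fixes U :: "'i \<Rightarrow> 'a::second_countable_topology measure set"
  assumes "\<And>i. i \<in> I \<Longrightarrow> openin weak_topology (U i)"
  obtains J where "countable J" "J \<subseteq> I" "(\<Union>i\<in>J. U i) = (\<Union>i\<in>I. U i)"
proof -
  obtain K where K: "countable K"
      "\<And>S. openin (weak_topology :: 'a measure topology) S \<Longrightarrow> union_generated K S"
    using weak_topology_countably_generated by blast
  define L where "L = {T \<in> K. \<exists>i\<in>I. T \<subseteq> U i}"
  then have "\<forall>T\<in>L. \<exists>i. i \<in> I \<and> T \<subseteq> U i"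
    by blast
  then obtain h where h: "\<And>T. T \<in> L \<Longrightarrow> h T \<in> I \<and> T \<subseteq> U (h T)"
    using bchoice by metis
  show thesis
  proof
    show "countable (h ` L)"
      using K(1) by (auto simp: L_def)
    show "h ` L \<subseteq> I"
      using h by auto
    show "(\<Union>i\<in>h ` L. U i) = (\<Union>i\<in>I. U i)"
    proof (intro equalityI subsetI)
      fix x assume "x \<in> (\<Union>i\<in>I. U i)"
      then obtain i where i: "i \<in> I" "x \<in> U i" by blast
      then obtain T where "T \<in> K" "x \<in> T" "T \<subseteq> U i"
        using K(2)[OF assms] unfolding union_generated_def by blast
      then have "T \<in> L" using i by (auto simp: L_def)
      with h \<open>x \<in> T\<close> show "x \<in> (\<Union>i\<in>h ` L. U i)" by blast
    qed (use h in blast)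
  qed
qed

section \<open>Costs and integrals of mixtures\<close>

text \<open>The two \<open>e2ennreal\<close> terms are the positive and negative parts of the
  difference. Written without subtraction, the relation between the parts can be integrated even
  where \<open>a\<close> is infinite; the next lemma recovers differences afterwards.\<close>

lemma ennreal_diff_add_swap:
  fixes a b :: ennreal
  assumes "b < \<infinity>"
  shows "e2ennreal (enn2ereal a - enn2ereal b) + b = e2ennreal (- (enn2ereal a - enn2ereal b)) + a"
proof -
  obtain r where r: "b = ennreal r" "0 \<le> r"
    using assms by (cases b) auto
  show ?thesis
  proof (cases a)
    case (real s)
    with r show ?thesis
      by (cases "s \<le> r") (simp_all add: ennreal_neg flip: ennreal_plus)
  next
    case top
    with r show ?thesis
      by (simp add: e2ennreal_neg)
  qed
qed

lemma ereal_diff_eq_if_add_swap: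
  fixes a b u v :: ennreal
  assumes "u + b = v + a" "b < \<infinity>" "v < \<infinity>"
  shows "enn2ereal u - enn2ereal v = enn2ereal a - enn2ereal b"
proof -
  obtain r where r: "b = ennreal r" "0 \<le> r" using assms by (cases b) auto
  obtain s where s: "v = ennreal s" "0 \<le> s" using assms by (cases v) auto
  show ?thesis
  proof (cases a; cases u)
    fix x y assume "0 \<le> x" "a = ennreal x" "0 \<le> y" "u = ennreal y"
    then show ?thesis
      using assms(1) r s by (simp flip: ennreal_plus)
  qed (use assms(1) r s in \<open>auto simp flip: ennreal_plus\<close>)
qed

text \<open>With \<open>u\<close> and \<open>v\<close> the parts of the cost of \<open>Q z\<close>,
  the identity \<open>u + B = v + A\<close> holds pointwise. Its integrated form can be rearranged
  into differences because \<open>B\<close> and \<open>v\<close> have finite integrals. Positive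
  costs may be infinite on either side.\<close>

lemma Cost_bind:
  fixes c :: "'a::topological_space \<Rightarrow> real"
  assumes c [measurable]: "c \<in> borel_measurable borel" and wd: "Cost_well_defined c"
    and p: "p \<in> space (prob_algebra F)" and Q: "Q \<in> F \<rightarrow>\<^sub>M prob_algebra borel"
  shows "Cost c (bind p Q) = ext_integral p (\<lambda>z. Cost c (Q z))"
proof -
  define A where "A z = (\<integral>\<^sup>+w. ennreal (c w) \<partial>Q z)" for z
  define B where "B z = (\<integral>\<^sup>+w. ennreal (- c w) \<partial>Q z)" for z
  have sets_p [measurable_cong]: "sets p = sets F"
    using p by (simp add: space_prob_algebra)
  have Qs [measurable]: "Q \<in> p \<rightarrow>\<^sub>M subprob_algebra borel"
    using measurable_prob_algebraD[OF Q] by simp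
  have [measurable]: "A \<in> borel_measurable p" "B \<in> borel_measurable p"
    unfolding A_def[abs_def] B_def[abs_def]
    by (rule measurable_compose[OF Qs nn_integral_measurable_subprob_algebra], measurable)+
  have B_fin: "B z < \<infinity>" if "z \<in> space p" for z
  proof -
    have "Q z \<in> space (prob_algebra borel)"
      using measurable_space[OF Q] that sets_eq_imp_space_eq[OF sets_p] by simp
    with wd show ?thesis
      by (simp add: Cost_well_defined_def B_def)
  qed
  define u where "u z = e2ennreal (Cost c (Q z))" for z
  define v where "v z = e2ennreal (- Cost c (Q z))" for z
  have Cost_Q: "Cost c (Q z) = enn2ereal (A z) - enn2ereal (B z)" for z
    by (simp add: Cost_def ext_integral_def A_def B_def)
  have [measurable]: "u \<in> borel_measurable p" "v \<in> borel_measurable p"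
    unfolding u_def[abs_def] v_def[abs_def] Cost_Q by measurable
  have uv: "u z + B z = v z + A z" if "z \<in> space p" for z
    using ennreal_diff_add_swap[OF B_fin[OF that]] by (simp add: u_def v_def Cost_Q)
  have vB: "v z \<le> B z" for z
    unfolding v_def Cost_Q
    by (cases "A z"; cases "B z") (auto simp: ennreal_neg e2ennreal_neg intro!: ennreal_leI)
  have int_A: "(\<integral>\<^sup>+w. ennreal (c w) \<partial>bind p Q) = (\<integral>\<^sup>+z. A z \<partial>p)"
    and int_B: "(\<integral>\<^sup>+w. ennreal (- c w) \<partial>bind p Q) = (\<integral>\<^sup>+z. B z \<partial>p)"
    unfolding A_def B_def by (simp_all add: nn_integral_bind[OF _ Qs])
  have "bind p Q \<in> space (prob_algebra borel)"
    using prob_space_bind'[OF p Q] sets_bind'[OF p Q] by (simp add: space_prob_algebra)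
  \<comment> \<open>Finiteness of each \<open>B z\<close> would not bound the integral of
    \<open>B\<close>; well-definedness of the cost is applied to the mixture itself.\<close>
  then have B_int: "(\<integral>\<^sup>+z. B z \<partial>p) < \<infinity>"
    using wd by (simp add: Cost_well_defined_def int_B[symmetric])
  have v_int: "(\<integral>\<^sup>+z. v z \<partial>p) < \<infinity>"
    using nn_integral_mono[of p v B] vB B_int by (meson le_less_trans)
  have "(\<integral>\<^sup>+z. u z \<partial>p) + (\<integral>\<^sup>+z. B z \<partial>p) = (\<integral>\<^sup>+z. u z + B z \<partial>p)"
    by (simp add: nn_integral_add)
  also have "\<dots> = (\<integral>\<^sup>+z. v z + A z \<partial>p)"
    by (intro nn_integral_cong uv)
  also have "\<dots> = (\<integral>\<^sup>+z. v z \<partial>p) + (\<integral>\<^sup>+z. A z \<partial>p)"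
    by (simp add: nn_integral_add)
  finally have "enn2ereal (\<integral>\<^sup>+z. u z \<partial>p) - enn2ereal (\<integral>\<^sup>+z. v z \<partial>p) =
      enn2ereal (\<integral>\<^sup>+z. A z \<partial>p) - enn2ereal (\<integral>\<^sup>+z. B z \<partial>p)"
    by (rule ereal_diff_eq_if_add_swap[OF _ B_int v_int])
  then show ?thesis
    by (simp add: Cost_def[of c "bind p Q"] ext_integral_def u_def v_def int_A int_B)
qed

text \<open>The functions in \<open>\<Omega>\<close> may be unbounded, so \<open>f\<close> is split
  into positive and negative parts, whose nonnegative integrals pass through the mixture.
  Integrability under every \<open>Q z\<close> makes the inner integral the true difference of the
  parts instead of the default value 0.\<close>

lemma
  fixes f :: "'b \<Rightarrow> real"
  assumes Q: "Q \<in> p \<rightarrow>\<^sub>M subprob_algebra N" and f: "integrable (bind p Q) f"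
    and p: "space p \<noteq> {}" and Qf: "\<And>z. z \<in> space p \<Longrightarrow> integrable (Q z) f"
  shows integrable_kernel_integral: "integrable p (\<lambda>z. \<integral>w. f w \<partial>Q z)"
    and integral_kernel_integral: "(\<integral>z. (\<integral>w. f w \<partial>Q z) \<partial>p) = (\<integral>w. f w \<partial>bind p Q)"
proof -
  note Q [measurable]
  have f_N [measurable]: "f \<in> borel_measurable N"
    using borel_measurable_integrable[OF f] sets_bind_measurable[OF Q p]
    by (simp cong: measurable_cong_sets)
  define A where "A z = (\<integral>\<^sup>+w. ennreal (f w) \<partial>Q z)" for z
  define B where "B z = (\<integral>\<^sup>+w. ennreal (- f w) \<partial>Q z)" for z
  have [measurable]: "A \<in> borel_measurable p" "B \<in> borel_measurable p"
    unfolding A_def[abs_def] B_def[abs_def]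
    by (rule measurable_compose[OF Q nn_integral_measurable_subprob_algebra], measurable)+
  have int_A: "(\<integral>\<^sup>+w. ennreal (f w) \<partial>bind p Q) = (\<integral>\<^sup>+z. A z \<partial>p)"
    and int_B: "(\<integral>\<^sup>+w. ennreal (- f w) \<partial>bind p Q) = (\<integral>\<^sup>+z. B z \<partial>p)"
    unfolding A_def B_def by (simp_all add: nn_integral_bind[OF _ Q])
  have fin: "A z \<noteq> \<infinity>" "B z \<noteq> \<infinity>" if "z \<in> space p" for z
    using Qf[OF that] unfolding A_def B_def real_integrable_def by auto
  have fin': "(\<integral>\<^sup>+z. A z \<partial>p) \<noteq> \<infinity>" "(\<integral>\<^sup>+z. B z \<partial>p) \<noteq> \<infinity>"
    using f unfolding int_A[symmetric] int_B[symmetric] real_integrable_def by auto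
  have eqA: "(\<integral>\<^sup>+z. ennreal (enn2real (A z)) \<partial>p) = (\<integral>\<^sup>+z. A z \<partial>p)"
    by (intro nn_integral_cong) (use fin in \<open>auto simp: less_top\<close>)
  have eqB: "(\<integral>\<^sup>+z. ennreal (enn2real (B z)) \<partial>p) = (\<integral>\<^sup>+z. B z \<partial>p)"
    by (intro nn_integral_cong) (use fin in \<open>auto simp: less_top\<close>)
  have iA: "integrable p (\<lambda>z. enn2real (A z))" and iB: "integrable p (\<lambda>z. enn2real (B z))"
    using fin' by (auto intro!: integrableI_bounded simp: eqA eqB less_top)
  have eq: "(\<integral>w. f w \<partial>Q z) = enn2real (A z) - enn2real (B z)" if "z \<in> space p" for z
    using real_lebesgue_integral_def[OF Qf[OF that]] by (simp add: A_def B_def)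
  show "integrable p (\<lambda>z. \<integral>w. f w \<partial>Q z)"
    using Bochner_Integration.integrable_diff[OF iA iB]
    by (subst Bochner_Integration.integrable_cong[OF refl eq])
  have "(\<integral>z. (\<integral>w. f w \<partial>Q z) \<partial>p) = (\<integral>z. enn2real (A z) - enn2real (B z) \<partial>p)"
    by (intro Bochner_Integration.integral_cong refl eq)
  also have "\<dots> = (\<integral>z. enn2real (A z) \<partial>p) - (\<integral>z. enn2real (B z) \<partial>p)"
    by (rule Bochner_Integration.integral_diff[OF iA iB])
  also have "\<dots> = enn2real (\<integral>\<^sup>+z. A z \<partial>p) - enn2real (\<integral>\<^sup>+z. B z \<partial>p)"
    by (simp add: integral_eq_nn_integral eqA eqB)
  also have "\<dots> = (\<integral>w. f w \<partial>bind p Q)"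
    using real_lebesgue_integral_def[OF f] by (simp add: int_A int_B)
  finally show "(\<integral>z. (\<integral>w. f w \<partial>Q z) \<partial>p) = (\<integral>w. f w \<partial>bind p Q)" .
qed

section \<open>Decompositions\<close>

lemma indicator_bounded_measurable: "A \<in> sets Z \<Longrightarrow> indicator A \<in> bounded_measurable Z"
  by (auto simp: bounded_measurable_def bounded_iff intro!: exI[of _ 1])

text \<open>The definition of a decomposition gives measurability of \<open>Q\<close> over
  \<open>Z\<close> only, but integrals of indicators are \<open>C0\<close>-measurable, and
  evaluations on sets generate the sigma-algebra of the target. \<open>Theta\<close> asks for this
  stronger measurability.\<close>

lemma decomposition_measurable:
  assumes dec: "is_decomposition Z C0 M Q" and sub: "subalgebra Z C0"
  shows "Q \<in> C0 \<rightarrow>\<^sub>M prob_algebra Z"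
proof -
  have Q: "prob_space (Q x)" "sets (Q x) = sets Z" if "x \<in> space C0" for x
  proof -
    have "Q x \<in> space (prob_algebra Z)"
      using dec sub that by (auto simp: is_decomposition_def subalgebra_def dest: measurable_space)
    then show "prob_space (Q x)" "sets (Q x) = sets Z"
      by (auto simp: space_prob_algebra)
  qed
  show ?thesis
  proof (intro measurable_prob_algebraI measurable_subprob_algebra)
    fix A assume A: "A \<in> sets Z"
    have "(\<lambda>x. \<integral>y. indicator A y \<partial>Q x :: real) \<in> borel_measurable C0"
      using dec indicator_bounded_measurable[OF A] by (auto simp: is_decomposition_def)
    then have "(\<lambda>x. ennreal (\<integral>y. indicator A y \<partial>Q x)) \<in> borel_measurable C0"
      by measurable
    then show "(\<lambda>x. emeasure (Q x) A) \<in> borel_measurable C0"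
    proof (rule measurable_cong[THEN iffD1, rotated])
      fix x assume x: "x \<in> space C0"
      interpret prob_space "Q x" by (rule Q(1)[OF x])
      have "A \<inter> space (Q x) = A"
        using A Q(2)[OF x] sets.sets_into_space by blast
      then show "ennreal (\<integral>y. indicator A y \<partial>Q x) = emeasure (Q x) A"
        by (simp add: emeasure_eq_measure)
    qed
  qed (use Q in \<open>auto intro: prob_space_imp_subprob_space\<close>)
qed

section \<open>Restriction of measures to sub-sigma-algebras and conditional expectations\<close>

lemma subalgebra_cong: "subalgebra Z C0 \<Longrightarrow> sets p = sets Z \<Longrightarrow> subalgebra p C0"
  by (auto simp: subalgebra_def dest: sets_eq_imp_space_eq)

lemma restr_to_subalg_in_prob_algebra:
  assumes "subalgebra Z C0" "p \<in> space (prob_algebra Z)"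
  shows "restr_to_subalg p C0 \<in> space (prob_algebra C0)"
proof -
  have "subalgebra p C0"
    using assms by (auto simp: space_prob_algebra intro: subalgebra_cong)
  then show ?thesis
    using assms by (simp add: space_prob_algebra sets_restr_to_subalg prob_space_restr_to_subalg)
qed

lemma bind_restr_to_subalg:
  assumes sub: "subalgebra p F" and Q: "Q \<in> F \<rightarrow>\<^sub>M subprob_algebra N" and ne: "space p \<noteq> {}"
  shows "bind (restr_to_subalg p F) Q = bind p Q"
proof (rule measure_eqI)
  have Qp: "Q \<in> p \<rightarrow>\<^sub>M subprob_algebra N" and Qr: "Q \<in> restr_to_subalg p F \<rightarrow>\<^sub>M subprob_algebra N"
    using measurable_from_subalg[OF sub Q] measurable_in_subalg[OF sub Q] .
  have ne': "space (restr_to_subalg p F) \<noteq> {}"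
    using ne by (simp add: space_restr_to_subalg)
  show "sets (bind (restr_to_subalg p F) Q) = sets (bind p Q)"
    using sets_bind_measurable[OF Qp ne] sets_bind_measurable[OF Qr ne'] by simp
  fix A assume "A \<in> sets (bind (restr_to_subalg p F) Q)"
  then have [measurable]: "A \<in> sets N"
    using sets_bind_measurable[OF Qr ne'] by simp
  have "(\<lambda>z. emeasure (Q z) A) \<in> borel_measurable F"
    by (rule measurable_compose[OF Q]) measurable
  from nn_integral_subalgebra2[OF sub this]
  show "emeasure (bind (restr_to_subalg p F) Q) A = emeasure (bind p Q) A"
    by (simp add: emeasure_bind[OF ne' Qr] emeasure_bind[OF ne Qp])
qed

text \<open>A \<open>C0\<close>-measurable function is its own conditional expectation given
  \<open>C0\<close>. Both sides are \<open>C0\<close>-measurable, so the exceptional set lies in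
  \<open>C0\<close> and the statement passes to the restricted measure.\<close>

lemma decomposition_AE_id:
  assumes dec: "is_decomposition Z C0 M Q" and sub: "subalgebra Z C0"
    and \<pi>: "\<pi> \<in> M" "\<pi> \<in> space (prob_algebra Z)"
    and g: "g \<in> bounded_measurable Z" "g \<in> borel_measurable C0"
  shows "AE z in restr_to_subalg \<pi> C0. (\<integral>w. g w \<partial>Q z) = g z"
proof -
  have sets_\<pi>: "sets \<pi> = sets Z" and "prob_space \<pi>"
    using \<pi>(2) by (auto simp: space_prob_algebra)
  interpret prob_space \<pi> by fact
  have sub': "subalgebra \<pi> C0"
    by (rule subalgebra_cong[OF sub sets_\<pi>])
  interpret finite_measure_subalgebra \<pi> C0
    by unfold_locales (rule sub')
  obtain b where b: "\<And>z. z \<in> space Z \<Longrightarrow> norm (g z) \<le> b"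
    using g(1) by (auto simp: bounded_measurable_def bounded_iff)
  have "integrable \<pi> g"
    using g(1) b sets_\<pi> sets_eq_imp_space_eq[OF sets_\<pi>]
    by (intro integrable_const_bound[where B=b]) (auto simp: bounded_measurable_def cong: measurable_cong_sets)
  then have "AE z in \<pi>. real_cond_exp \<pi> C0 g z = g z"
    using g(2) by (rule real_cond_exp_F_meas)
  moreover have "AE z in \<pi>. (\<integral>w. g w \<partial>Q z) = real_cond_exp \<pi> C0 g z"
    using dec \<pi>(1) g(1) by (auto simp: is_decomposition_def)
  ultimately have "AE z in \<pi>. (\<integral>w. g w \<partial>Q z) = g z"
    by eventually_elim simp
  moreover have [measurable]: "(\<lambda>z. \<integral>w. g w \<partial>Q z) \<in> borel_measurable C0" "g \<in> borel_measurable C0"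
    using dec g by (auto simp: is_decomposition_def)
  ultimately show ?thesis
    by (intro AE_restr_to_subalg2[OF sub']) measurable
qed

text \<open>The integral of \<open>f\<close> under \<open>Q z\<close> acts as a conditional
  expectation of the possibly unbounded \<open>f\<close>: its integral over each \<open>S\<close> in
  \<open>C0\<close> equals that of \<open>f\<close> under \<open>\<pi>\<close>, hence vanishes. The
  decomposition property, which concerns bounded functions, is applied to indicators of
  \<open>S\<close> only.\<close>

lemma decomposition_integral_AE_zero:
  assumes dec: "is_decomposition Z C0 M Q" and sub: "subalgebra Z C0"
    and \<pi>: "\<pi> \<in> M" "\<pi> \<in> space (prob_algebra Z)" and inv: "bind (restr_to_subalg \<pi> C0) Q = \<pi>"
    and f: "integrable \<pi> f" "\<And>z. z \<in> space Z \<Longrightarrow> integrable (Q z) f"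
    and zero: "\<And>S. S \<in> sets C0 \<Longrightarrow> (LINT z:S|\<pi>. f z) = 0"
  shows "AE z in restr_to_subalg \<pi> C0. (\<integral>w. f w \<partial>Q z) = (0::real)"
proof -
  define p where "p = restr_to_subalg \<pi> C0"
  have sets_\<pi>: "sets \<pi> = sets Z" and "prob_space \<pi>"
    using \<pi>(2) by (auto simp: space_prob_algebra)
  interpret prob_space \<pi> by fact
  have sub': "subalgebra \<pi> C0"
    by (rule subalgebra_cong[OF sub sets_\<pi>])
  have space_p: "space p = space Z" "space p \<noteq> {}"
    using sets_eq_imp_space_eq[OF sets_\<pi>] not_empty by (auto simp: p_def space_restr_to_subalg)
  have sets_p: "sets p = sets C0"
    by (simp add: p_def sets_restr_to_subalg[OF sub'])
  have Q: "Q \<in> p \<rightarrow>\<^sub>M prob_algebra Z"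
    using decomposition_measurable[OF dec sub] sets_p by (simp cong: measurable_cong_sets)
  have Qs: "Q \<in> p \<rightarrow>\<^sub>M subprob_algebra Z"
    by (rule measurable_prob_algebraD[OF Q])
  have inv_p: "bind p Q = \<pi>"
    using inv by (simp add: p_def)
  have Qz: "prob_space (Q z)" "sets (Q z) = sets Z" "space (Q z) = space Z" if "z \<in> space p" for z
    using measurable_space[OF Q that] by (auto simp: space_prob_algebra dest: sets_eq_imp_space_eq)
  interpret p: prob_space p
    unfolding p_def by (rule prob_space_restr_to_subalg[OF sub' \<open>prob_space \<pi>\<close>])
  have "AE z in p. (\<integral>w. f w \<partial>Q z) = 0"
  proof (rule p.density_zero)
    show "integrable p (\<lambda>z. \<integral>w. f w \<partial>Q z)"
      using f space_p by (intro integrable_kernel_integral[OF Qs]) (auto simp: inv_p)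
    fix S assume "S \<in> sets p"
    then have S: "S \<in> sets C0" "S \<in> sets Z" "S \<in> sets \<pi>" "S \<in> sets p"
      using sub sets_p sets_\<pi> by (auto simp: subalgebra_def)
    have ind: "AE z in p. (\<integral>w. indicator S w \<partial>Q z) = (indicator S z :: real)"
      unfolding p_def using S
      by (intro decomposition_AE_id[OF dec sub \<pi>] indicator_bounded_measurable) auto
    \<comment> \<open>By \<open>ind\<close>, almost every \<open>Q z\<close> gives \<open>S\<close>
      mass 1 if \<open>z\<close> is in \<open>S\<close> and mass 0 otherwise, so the indicator can
      be pulled out of the inner integral.\<close>
    have AE_eq: "AE z in p. (\<integral>w. indicator S w *\<^sub>R f w \<partial>Q z) = indicator S z *\<^sub>R (\<integral>w. f w \<partial>Q z)"
      using ind AE_space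
    proof eventually_elim
      case (elim z)
      interpret Qz: prob_space "Q z" by (rule Qz(1)[OF elim(2)])
      have SQ: "S \<in> Qz.events" and "S \<inter> space (Q z) = S"
        using S Qz[OF elim(2)] sets.sets_into_space by auto
      then have m: "Qz.prob S = indicator S z"
        using elim(1) by simp
      have f_Q [measurable]: "f \<in> borel_measurable (Q z)"
        using f(2) elim(2) space_p by auto
      show ?case
      proof (cases "z \<in> S")
        case True
        then have "AE w in Q z. w \<in> S"
          using m Qz.AE_prob_1 by simp
        then have "(\<integral>w. indicator S w *\<^sub>R f w \<partial>Q z) = (\<integral>w. f w \<partial>Q z)"
          using SQ by (intro integral_cong_AE) auto
        then show ?thesis using True by simp
      next
        case False
        then have "AE w in Q z. w \<notin> S"
          using m SQ Qz.prob_eq_0 by simp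
        then have "(\<integral>w. indicator S w *\<^sub>R f w \<partial>Q z) = (\<integral>w. 0 \<partial>Q z)"
          using SQ by (intro integral_cong_AE) auto
        then show ?thesis using False by simp
      qed
    qed
    have i1: "integrable p (\<lambda>z. \<integral>w. indicator S w *\<^sub>R f w \<partial>Q z)"
      and i2: "(\<integral>z. (\<integral>w. indicator S w *\<^sub>R f w \<partial>Q z) \<partial>p) = (\<integral>w. indicator S w *\<^sub>R f w \<partial>\<pi>)"
      using integrable_kernel_integral[OF Qs, of "\<lambda>w. indicator S w *\<^sub>R f w"]
        integral_kernel_integral[OF Qs, of "\<lambda>w. indicator S w *\<^sub>R f w"] S f space_p Qz(2)
      by (auto simp: inv_p intro!: integrable_mult_indicator simp del: real_scaleR_def)
    have i3: "integrable p (\<lambda>z. indicator S z *\<^sub>R (\<integral>w. f w \<partial>Q z))"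
      using f space_p S by (intro integrable_mult_indicator integrable_kernel_integral[OF Qs]) (auto simp: inv_p)
    from AE_eq have "(\<integral>z. (\<integral>w. indicator S w *\<^sub>R f w \<partial>Q z) \<partial>p) = (\<integral>z. indicator S z *\<^sub>R (\<integral>w. f w \<partial>Q z) \<partial>p)"
      by (intro integral_cong_AE borel_measurable_integrable i1 i3)
    then have "(\<integral>z. indicator S z *\<^sub>R (\<integral>w. f w \<partial>Q z) \<partial>p) = (\<integral>w. indicator S w *\<^sub>R f w \<partial>\<pi>)"
      by (simp only: i2)
    then show "(LINT z:S|p. (\<integral>w. f w \<partial>Q z)) = 0"
      using zero[OF S(1)] by (simp add: set_lebesgue_integral_def)
  qed
  then show ?thesis
    unfolding p_def .
qed

section \<open>Marginals of the conditional measures\<close>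

lemma simplex_kernel_in:
  assumes "simplex_with Z MX A0 QX" "x \<in> space Z"
  shows "QX x \<in> MX"
proof -
  have "QX x \<in> extreme_boundary Z MX"
    using assms by (simp add: simplex_with_def)
  then show ?thesis
    by (simp add: extreme_boundary_def)
qed

text \<open>
  Members of \<open>MX\<close> are determined by their integrals of the \<open>A0\<close>-measurable functions
  \<open>QX(1\<^sub>A)\<close>, and those composed with \<open>h\<close> are left unchanged by \<open>Q\<close>.
\<close>

lemma AE_distr_decomposition_eq:
  assumes simplex: "simplex_with Z MX A0 QX"
    and dec: "is_decomposition W C0 M Q" and sub: "subalgebra W C0"
    and \<pi>: "\<pi> \<in> M" "\<pi> \<in> space (prob_algebra W)"
    and h: "h \<in> C0 \<rightarrow>\<^sub>M A0" "h \<in> W \<rightarrow>\<^sub>M Z"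
    and marg: "\<And>z. z \<in> space W \<Longrightarrow> distr (Q z) Z h \<in> MX"
  shows "AE z in restr_to_subalg \<pi> C0. distr (Q z) Z h = QX (h z)"
proof -
  have decX: "is_decomposition Z A0 MX QX" and kerX: "ergodic_kernel Z MX QX"
    using simplex by (auto simp: simplex_with_def)
  \<comment> \<open>The countable separating family \<open>D\<close> obtained next reduces equality
    of two members of \<open>MX\<close> to countably many equalities, each of which may fail on its
    own null set.\<close>
  have QX: "QX \<in> Z \<rightarrow>\<^sub>M prob_algebra Z" and MX: "MX = invariant_probs Z QX"
    using kerX by (auto simp: ergodic_kernel_def)
  obtain D where D: "D \<subseteq> sets Z" "countable D"
      "\<And>\<mu> \<nu>. \<mu> \<in> MX \<Longrightarrow> \<nu> \<in> MX \<Longrightarrow> (\<And>A. A \<in> D \<Longrightarrow> measure \<mu> A = measure \<nu> A) \<Longrightarrow> \<mu> = \<nu>"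
    using simplex unfolding simplex_with_def ergodic_decomposable_simplex_def separable_measures_def
    by meson
  have Q_W: "Q \<in> W \<rightarrow>\<^sub>M prob_algebra W"
    using dec by (simp add: is_decomposition_def)
  have space_r: "space (restr_to_subalg \<pi> C0) = space W"
    using \<pi>(2) by (auto simp: space_restr_to_subalg space_prob_algebra dest: sets_eq_imp_space_eq)
  have "AE z in restr_to_subalg \<pi> C0. measure (distr (Q z) Z h) A = measure (QX (h z)) A"
    if "A \<in> D" for A
  proof -
    have A [measurable]: "A \<in> sets Z"
      using that D(1) by blast
    define g where "g u = (\<integral>y. indicator A y \<partial>QX u :: real)" for u
    have g: "g \<in> borel_measurable A0"
      using decX indicator_bounded_measurable[OF A] unfolding g_def is_decomposition_def by blast
    have QX_u: "prob_space (QX u)" "sets (QX u) = sets Z" if "u \<in> space Z" for u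
      using measurable_space[OF QX that] by (auto simp: space_prob_algebra)
    have g_eq: "g u = measure (QX u) A" if "u \<in> space Z" for u
      using sets.sets_into_space[OF A] sets_eq_imp_space_eq[OF QX_u(2)[OF that]]
      by (simp add: g_def Int_absorb2)
    have g_Z: "g \<in> borel_measurable Z"
      using g simplex by (auto simp: simplex_with_def H_sufficient_def intro: measurable_from_subalg)
    have "\<bar>g u\<bar> \<le> 1" if "u \<in> space Z" for u
      using prob_space.prob_le_1[OF QX_u(1)[OF that]] by (simp add: g_eq[OF that])
    then have "(\<lambda>z. g (h z)) \<in> bounded_measurable W"
      using measurable_compose[OF h(2) g_Z] measurable_space[OF h(2)]
      by (auto simp: bounded_measurable_def bounded_iff intro!: exI[of _ 1])
    moreover have "(\<lambda>z. g (h z)) \<in> borel_measurable C0"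
      using measurable_compose[OF h(1) g] .
    ultimately have "AE z in restr_to_subalg \<pi> C0. (\<integral>w. g (h w) \<partial>Q z) = g (h z)"
      by (rule decomposition_AE_id[OF dec sub \<pi>])
    then show ?thesis
      using AE_space
    proof eventually_elim
      case (elim z)
      then have z: "z \<in> space W"
        using space_r by simp
      define \<gamma> where "\<gamma> = distr (Q z) Z h"
      have "\<gamma> \<in> invariant_probs Z QX"
        using marg[OF z] by (simp add: \<gamma>_def MX)
      then have \<gamma>: "sets \<gamma> = sets Z" "prob_space \<gamma>" "bind \<gamma> QX = \<gamma>"
        by (auto simp: invariant_probs_def space_prob_algebra)
      interpret \<gamma>: prob_space \<gamma> by fact
      have QX_\<gamma>: "QX \<in> \<gamma> \<rightarrow>\<^sub>M subprob_algebra Z"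
        using measurable_prob_algebraD[OF QX] \<gamma>(1) by (simp cong: measurable_cong_sets)
      have ind_int: "integrable N (indicator A :: _ \<Rightarrow> real)" if "prob_space N" "sets N = sets Z" for N
        using that A by (intro finite_measure.integrable_const_bound[where B=1])
          (auto simp: prob_space_def cong: measurable_cong_sets)
      \<comment> \<open>Invariance of \<open>\<gamma>\<close> under \<open>QX\<close> writes its
        mass on \<open>A\<close> as the integral of \<open>g\<close>. Pulled back along
        \<open>h\<close>, this is an integral under \<open>Q z\<close>, which \<open>elim(1)\<close>
        evaluates.\<close>
      have "measure \<gamma> A = (\<integral>y. indicator A y \<partial>bind \<gamma> QX)"
        using sets.sets_into_space[OF A] sets_eq_imp_space_eq[OF \<gamma>(1)] by (simp add: \<gamma>(3) Int_absorb2)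
      also have "\<dots> = (\<integral>u. g u \<partial>\<gamma>)"
        unfolding g_def
        using ind_int \<gamma> QX_u sets_eq_imp_space_eq[OF \<gamma>(1)] \<gamma>.not_empty
        by (intro integral_kernel_integral[symmetric, OF QX_\<gamma>]) auto
      also have "\<dots> = (\<integral>w. g (h w) \<partial>Q z)"
      proof -
        have "sets (Q z) = sets W"
          using measurable_space[OF Q_W z] by (simp add: space_prob_algebra)
        then have "h \<in> Q z \<rightarrow>\<^sub>M Z"
          using h(2) by (simp cong: measurable_cong_sets)
        then show ?thesis
          unfolding \<gamma>_def using g_Z by (rule integral_distr)
      qed
      also have "\<dots> = measure (QX (h z)) A"
        using elim(1) g_eq measurable_space[OF h(2) z] by simp
      finally show ?case
        by (simp add: \<gamma>_def)
    qed
  qed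
  then have "AE z in restr_to_subalg \<pi> C0. \<forall>A\<in>D. measure (distr (Q z) Z h) A = measure (QX (h z)) A"
    using D(2) by (simp add: AE_ball_countable)
  then show ?thesis
    using AE_space
  proof eventually_elim
    case (elim z)
    then show ?case
      using D(3) marg simplex_kernel_in[OF simplex] measurable_space[OF h(2)] space_r by simp
  qed
qed

section \<open>Reduction to plans on the invariant algebras\<close>

lemma borel_subalgebra_space: "subalgebra borel F \<Longrightarrow> space F = UNIV"
  by (simp add: subalgebra_def)

lemma fst_snd_measurable_borel:
  "fst \<in> (borel :: ('a::polish_space \<times> 'b::polish_space) measure) \<rightarrow>\<^sub>M borel"
  "snd \<in> (borel :: ('a::polish_space \<times> 'b::polish_space) measure) \<rightarrow>\<^sub>M borel"
  unfolding borel_prod[symmetric] by measurable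

lemma fst_snd_measurable_subalgebra:
  assumes "subalgebra borel A0" "subalgebra borel B0" "subalgebra borel C" "sets (A0 \<Otimes>\<^sub>M B0) \<subseteq> sets C"
  shows "fst \<in> C \<rightarrow>\<^sub>M A0" "snd \<in> C \<rightarrow>\<^sub>M B0"
proof -
  have "subalgebra C (A0 \<Otimes>\<^sub>M B0)"
    using assms by (simp add: subalgebra_def space_pair_measure)
  then show "fst \<in> C \<rightarrow>\<^sub>M A0" "snd \<in> C \<rightarrow>\<^sub>M B0"
    by (intro measurable_from_subalg[OF _ measurable_fst] measurable_from_subalg[OF _ measurable_snd]; assumption)+
qed

text \<open>Preimages under \<open>h\<close> of sets in \<open>G\<close> lie in \<open>F\<close>, so
  restricting and projecting in either order measures the same preimage. This shows that the
  restriction of a plan to \<open>AB0\<close> has the marginals required of a tilde plan.\<close>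

lemma distr_restr_to_subalg:
  assumes F: "subalgebra p F" and h: "h \<in> p \<rightarrow>\<^sub>M N" "h \<in> F \<rightarrow>\<^sub>M G" and G: "subalgebra N G"
  shows "distr (restr_to_subalg p F) G h = restr_to_subalg (distr p N h) G"
proof (rule measure_eqI)
  have G': "subalgebra (distr p N h) G"
    using G by (simp add: subalgebra_def)
  show "sets (distr (restr_to_subalg p F) G h) = sets (restr_to_subalg (distr p N h) G)"
    by (simp add: sets_restr_to_subalg[OF G'])
  fix A assume "A \<in> sets (distr (restr_to_subalg p F) G h)"
  then have A: "A \<in> sets G" "A \<in> sets N"
    using G by (auto simp: subalgebra_def)
  have sp: "space p = space F"
    using F by (simp add: subalgebra_def)
  show "emeasure (distr (restr_to_subalg p F) G h) A = emeasure (restr_to_subalg (distr p N h) G) A"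
    using A h measurable_sets[OF h(2) A(1)] measurable_in_subalg[OF F h(2)]
    by (simp add: emeasure_distr emeasure_restr_to_subalg[OF G'] emeasure_restr_to_subalg[OF F]
        space_restr_to_subalg sp)
qed

text \<open>By weak regularity, violating a given constraint is a relatively open condition on the
  measures with admissible marginals. Countably many of these open sets have the same union as all
  of them, so a measure that violates any constraint violates one from
  \<open>\<Omega>'\<close>.\<close>

lemma weakly_regular_countable_constraints:
  fixes \<Omega> :: "('a::polish_space \<times> 'b::polish_space \<Rightarrow> real) set"
  assumes "weakly_regular \<Omega> MX MY"
  obtains \<Omega>' where "countable \<Omega>'" "\<Omega>' \<subseteq> \<Omega>"
    "\<And>\<gamma>. \<gamma> \<in> with_marginals_in MX MY \<Longrightarrow> (\<And>\<omega>. \<omega> \<in> \<Omega>' \<Longrightarrow> (\<integral>z. \<omega> z \<partial>\<gamma>) = 0) \<Longrightarrow>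
      \<gamma> \<in> restricted_probs \<Omega> MX MY"
proof -
  let ?W = "with_marginals_in MX MY"
  have W_sub: "?W \<subseteq> topspace weak_topology"
    by (auto simp: with_marginals_in_def topspace_weak_topology)
  have int: "integrable \<gamma> \<omega>" if "\<omega> \<in> \<Omega>" "\<gamma> \<in> ?W" for \<omega> \<gamma>
    using assms that by (simp add: weakly_regular_def)
  have "\<forall>\<omega>\<in>\<Omega>. \<exists>U. openin weak_topology U \<and> {\<gamma> \<in> ?W. (\<integral>z. \<omega> z \<partial>\<gamma>) \<noteq> 0} = U \<inter> ?W"
  proof
    fix \<omega> assume "\<omega> \<in> \<Omega>"
    have "continuous_map (subtopology weak_topology ?W) euclideanreal (\<lambda>\<gamma>. \<integral>z. \<omega> z \<partial>\<gamma>)"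
      using assms \<open>\<omega> \<in> \<Omega>\<close> by (simp add: weakly_regular_def)
    from openin_continuous_map_preimage[OF this, of "- {0}"]
    have "openin (subtopology weak_topology ?W) {\<gamma> \<in> ?W. (\<integral>z. \<omega> z \<partial>\<gamma>) \<noteq> 0}"
      using W_sub by (simp add: Int_absorb1 open_Compl flip: open_openin)
    then show "\<exists>U. openin weak_topology U \<and> {\<gamma> \<in> ?W. (\<integral>z. \<omega> z \<partial>\<gamma>) \<noteq> 0} = U \<inter> ?W"
      by (simp add: openin_subtopology)
  qed
  from bchoice[OF this] obtain U where U: "\<And>\<omega>. \<omega> \<in> \<Omega> \<Longrightarrow> openin weak_topology (U \<omega>)"
      "\<And>\<omega>. \<omega> \<in> \<Omega> \<Longrightarrow> {\<gamma> \<in> ?W. (\<integral>z. \<omega> z \<partial>\<gamma>) \<noteq> 0} = U \<omega> \<inter> ?W"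
    by blast
  obtain \<Omega>' where \<Omega>': "countable \<Omega>'" "\<Omega>' \<subseteq> \<Omega>" "(\<Union>\<omega>\<in>\<Omega>'. U \<omega>) = (\<Union>\<omega>\<in>\<Omega>. U \<omega>)"
    by (rule weak_topology_hereditarily_Lindelof[OF U(1)])
  show thesis
  proof (rule that[OF \<Omega>'(1,2)])
    fix \<gamma> assume \<gamma>: "\<gamma> \<in> ?W" and zero: "\<And>\<omega>. \<omega> \<in> \<Omega>' \<Longrightarrow> (\<integral>z. \<omega> z \<partial>\<gamma>) = 0"
    have "(\<integral>z. \<omega> z \<partial>\<gamma>) = 0" if \<omega>: "\<omega> \<in> \<Omega>" for \<omega>
    proof (rule ccontr)
      assume "(\<integral>z. \<omega> z \<partial>\<gamma>) \<noteq> 0"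
      with \<gamma> have "\<gamma> \<in> U \<omega> \<inter> ?W"
        unfolding U(2)[OF \<omega>, symmetric] by simp
      with \<omega> have "\<gamma> \<in> (\<Union>\<omega>\<in>\<Omega>. U \<omega>)"
        by (intro UN_I[of \<omega>]) simp_all
      then obtain \<omega>' where \<omega>': "\<omega>' \<in> \<Omega>'" "\<gamma> \<in> U \<omega>'"
        unfolding \<Omega>'(3)[symmetric] by (elim UN_E)
      then have "\<gamma> \<in> {\<gamma> \<in> ?W. (\<integral>z. \<omega>' z \<partial>\<gamma>) \<noteq> 0}"
        using \<gamma> by (subst U(2)[OF subsetD[OF \<Omega>'(2) \<omega>'(1)]]) simp
      with zero[OF \<omega>'(1)] show False
        by simp
    qed
    then show "\<gamma> \<in> restricted_probs \<Omega> MX MY"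
      unfolding restricted_probs_def using \<gamma> int[OF _ \<gamma>]
      by (intro CollectI conjI ballI)
  qed
qed

lemma simplex_kernel_in_Theta:
  fixes \<Omega> :: "('a::polish_space \<times> 'b::polish_space \<Rightarrow> real) set"
  assumes X: "simplex_with borel MX A0 QX" and Y: "simplex_with borel MY B0 QY"
    and reg: "weakly_regular \<Omega> MX MY"
    and erg: "ergodic_decomposable_with \<Omega> MX MY A0 B0 M AB0 QM"
    and coh: "coherent \<Omega> MX MY AB0"
    and \<pi>: "\<pi> \<in> restricted_plans \<Omega> MX MY \<mu> \<nu>"
  shows "(\<pi>, QM) \<in> Theta \<Omega> MX MY QX QY AB0 \<mu> \<nu>"
proof -
  have simplex: "simplex_with borel M AB0 QM" and M: "restricted_probs \<Omega> MX MY \<subseteq> M"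
    and prod: "sets (A0 \<Otimes>\<^sub>M B0) \<subseteq> sets AB0"
    and bnd: "\<And>\<gamma>. \<gamma> \<in> extreme_boundary borel M \<Longrightarrow>
      distr \<gamma> borel fst \<in> extreme_boundary borel MX \<and> distr \<gamma> borel snd \<in> extreme_boundary borel MY"
    using erg by (auto simp: ergodic_decomposable_with_def)
  have sub: "subalgebra borel AB0" and dec: "is_decomposition borel AB0 M QM"
    and ker: "ergodic_kernel borel M QM" and bndM: "extreme_boundary borel M = range QM"
    using simplex by (auto simp: simplex_with_def H_sufficient_def)
  have subX: "subalgebra borel A0" and subY: "subalgebra borel B0"
    using X Y by (auto simp: simplex_with_def H_sufficient_def)
  note proj = fst_snd_measurable_subalgebra[OF subX subY sub prod]
  have \<pi>_R: "\<pi> \<in> restricted_probs \<Omega> MX MY"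
    using \<pi> by (simp add: restricted_plans_def)
  then have \<pi>_M: "\<pi> \<in> M" and \<pi>_W: "\<pi> \<in> with_marginals_in MX MY"
    using M by (auto simp: restricted_probs_def)
  then have \<pi>_P: "\<pi> \<in> space (prob_algebra borel)"
    by (simp add: with_marginals_in_def)
  then have sets_\<pi>: "sets \<pi> = sets borel"
    by (simp add: space_prob_algebra)
  then have space_\<pi>: "space \<pi> = UNIV"
    by (auto dest: sets_eq_imp_space_eq)
  have sub_\<pi>: "subalgebra \<pi> AB0"
    by (rule subalgebra_cong[OF sub sets_\<pi>])
  have QM: "QM \<in> AB0 \<rightarrow>\<^sub>M prob_algebra borel"
    by (rule decomposition_measurable[OF dec sub])
  \<comment> \<open>Members of \<open>M\<close> are \<open>QM\<close>-invariant, and mixing over the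
    restriction gives the same measure because \<open>QM\<close> is
    \<open>AB0\<close>-measurable.\<close>
  have inv: "bind (restr_to_subalg \<pi> AB0) QM = \<pi>"
    using bind_restr_to_subalg[OF sub_\<pi> measurable_prob_algebraD[OF QM]] ker \<pi>_M space_\<pi>
    by (auto simp: ergodic_kernel_def invariant_probs_def)
  \<comment> \<open>Each \<open>QM z\<close> is a boundary point of \<open>M\<close>, so its
    marginals are admissible for every \<open>z\<close>, without exceptional set. Weak regularity
    then makes each constraint function integrable under every \<open>QM z\<close>.\<close>
  have QM_W: "QM z \<in> with_marginals_in MX MY" for z
  proof -
    have "QM z \<in> space (prob_algebra borel)"
      using measurable_space[OF QM] borel_subalgebra_space[OF sub] by simp
    then show ?thesis
      using bnd[of "QM z"] bndM by (auto simp: with_marginals_in_def extreme_boundary_def)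
  qed
  then have marg: "distr (QM z) borel fst \<in> MX" "distr (QM z) borel snd \<in> MY" for z
    by (auto simp: with_marginals_in_def)
  have mX: "AE z in restr_to_subalg \<pi> AB0. distr (QM z) borel fst = QX (fst z)"
    by (rule AE_distr_decomposition_eq[OF X dec sub \<pi>_M \<pi>_P proj(1) fst_snd_measurable_borel(1) marg(1)])
  have mY: "AE z in restr_to_subalg \<pi> AB0. distr (QM z) borel snd = QY (snd z)"
    by (rule AE_distr_decomposition_eq[OF Y dec sub \<pi>_M \<pi>_P proj(2) fst_snd_measurable_borel(2) marg(2)])
  obtain \<Omega>' where \<Omega>': "countable \<Omega>'" "\<Omega>' \<subseteq> \<Omega>"
    "\<And>\<gamma>. \<gamma> \<in> with_marginals_in MX MY \<Longrightarrow> (\<And>\<omega>. \<omega> \<in> \<Omega>' \<Longrightarrow> (\<integral>z. \<omega> z \<partial>\<gamma>) = 0) \<Longrightarrow>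
      \<gamma> \<in> restricted_probs \<Omega> MX MY"
    using weakly_regular_countable_constraints[OF reg] by blast
  have "AE z in restr_to_subalg \<pi> AB0. (\<integral>w. \<omega> w \<partial>QM z) = 0" if "\<omega> \<in> \<Omega>'" for \<omega>
  proof (rule decomposition_integral_AE_zero[OF dec sub \<pi>_M \<pi>_P inv])
    have "\<forall>\<gamma>\<in>with_marginals_in MX MY. integrable \<gamma> \<omega>"
      using reg that \<Omega>'(2) unfolding weakly_regular_def by blast
    then show "integrable \<pi> \<omega>" "integrable (QM z) \<omega>" for z
      using QM_W \<pi>_W by blast+
    show "(LINT z:S|\<pi>. \<omega> z) = 0" if "S \<in> sets AB0" for S
      using coh \<pi>_R that \<open>\<omega> \<in> \<Omega>'\<close> \<Omega>'(2) by (auto simp: coherent_def)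
  qed
  \<comment> \<open>Countability of \<open>\<Omega>'\<close> collects the exceptional sets of the
    single constraints into one null set.\<close>
  then have "AE z in restr_to_subalg \<pi> AB0. \<forall>\<omega>\<in>\<Omega>'. (\<integral>w. \<omega> w \<partial>QM z) = 0"
    using \<Omega>'(1) by (simp add: AE_ball_countable)
  then have "AE z in restr_to_subalg \<pi> AB0. QM z \<in> restricted_plans \<Omega> MX MY (QX (fst z)) (QY (snd z))"
    using mX mY by eventually_elim (use QM_W \<Omega>'(3) in \<open>auto simp: restricted_plans_def\<close>)
  then have "AE (x, y) in restr_to_subalg \<pi> AB0. QM (x, y) \<in> restricted_plans \<Omega> MX MY (QX x) (QY y)"
    unfolding case_prod_beta' prod.collapse .
  then show ?thesis
    using \<pi> QM inv by (simp add: Theta_def)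
qed

theorem theorem5p5:
  fixes c :: "'a::polish_space \<times> 'b::polish_space \<Rightarrow> real"
    and \<Omega> :: "('a \<times> 'b \<Rightarrow> real) set"
    and MX :: "'a measure set" and A0 :: "'a measure" and QX :: "'a \<Rightarrow> 'a measure"
    and MY :: "'b measure set" and B0 :: "'b measure" and QY :: "'b \<Rightarrow> 'b measure"
    and M :: "('a \<times> 'b) measure set" and AB0 :: "('a \<times> 'b) measure"
    and QM Qopt :: "'a \<times> 'b \<Rightarrow> ('a \<times> 'b) measure"
    and \<mu> :: "'a measure" and \<nu> :: "'b measure"
  assumes "c \<in> borel_measurable borel"
    and "Cost_well_defined c"
    and "lower_semicontinuous weak_topology (Cost c)"
    and "simplex_with borel MX A0 QX"
    and "simplex_with borel MY B0 QY"
    and "linear_restriction \<Omega> MX MY"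
    and "weakly_regular \<Omega> MX MY"
    and "ergodic_decomposable_with \<Omega> MX MY A0 B0 M AB0 QM"
    and "coherent \<Omega> MX MY AB0"
    and "\<mu> \<in> MX" and "\<nu> \<in> MY"
    and "optimal_kernel c \<Omega> MX MY A0 B0 QX QY AB0 \<mu> \<nu> Qopt"
  shows "(INF \<pi>\<in>restricted_plans \<Omega> MX MY \<mu> \<nu>. Cost c \<pi>)
       = (INF p\<in>tilde_plans A0 B0 AB0 (restr_to_subalg \<mu> A0) (restr_to_subalg \<nu> B0).
            ext_integral p (\<lambda>z. Cost c (Qopt z)))
       \<and> (INF p\<in>tilde_plans A0 B0 AB0 (restr_to_subalg \<mu> A0) (restr_to_subalg \<nu> B0).
            ext_integral p (\<lambda>z. Cost c (Qopt z)))
       = (INF p\<in>tilde_plans A0 B0 AB0 (restr_to_subalg \<mu> A0) (restr_to_subalg \<nu> B0).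
            ext_integral p (\<lambda>(x, y). INF \<pi>\<in>restricted_plans \<Omega> MX MY (QX x) (QY y). Cost c \<pi>))"
proof -
  let ?T = "tilde_plans A0 B0 AB0 (restr_to_subalg \<mu> A0) (restr_to_subalg \<nu> B0)"
  let ?R = "restricted_plans \<Omega> MX MY"
  note X = assms(4) and Y = assms(5) and erg = assms(8)
  have Q: "Qopt \<in> AB0 \<rightarrow>\<^sub>M prob_algebra borel"
    and opt: "\<And>x y. Cost c (Qopt (x, y)) = (INF \<pi>\<in>?R (QX x) (QY y). Cost c \<pi>)"
    and least: "\<And>\<pi> Q. (\<pi>, Q) \<in> Theta \<Omega> MX MY QX QY AB0 \<mu> \<nu> \<Longrightarrow>
      Cost c (bind (restr_to_subalg \<pi> AB0) Qopt) \<le> Cost c (bind (restr_to_subalg \<pi> AB0) Q)"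
    and lift: "\<And>p. p \<in> ?T \<Longrightarrow> (bind p Qopt, Qopt) \<in> Theta \<Omega> MX MY QX QY AB0 \<mu> \<nu>"
    using assms(12) unfolding optimal_kernel_def by blast+
  have sub: "subalgebra borel AB0" and subX: "subalgebra borel A0" and subY: "subalgebra borel B0"
    and prod: "sets (A0 \<Otimes>\<^sub>M B0) \<subseteq> sets AB0"
    using X Y erg by (auto simp: ergodic_decomposable_with_def simplex_with_def H_sufficient_def)
  note proj = fst_snd_measurable_subalgebra[OF subX subY sub prod]
  have Cost_mix: "Cost c (bind p Qopt) = ext_integral p (\<lambda>z. Cost c (Qopt z))"
    if "p \<in> space (prob_algebra AB0)" for p
    by (rule Cost_bind[OF assms(1,2) that Q])
  have "(INF \<pi>\<in>?R \<mu> \<nu>. Cost c \<pi>) \<le> (INF p\<in>?T. ext_integral p (\<lambda>z. Cost c (Qopt z)))"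
  proof (rule INF_greatest)
    fix p assume p: "p \<in> ?T"
    then have "bind p Qopt \<in> ?R \<mu> \<nu>"
      using lift by (auto simp: Theta_def)
    then show "(INF \<pi>\<in>?R \<mu> \<nu>. Cost c \<pi>) \<le> ext_integral p (\<lambda>z. Cost c (Qopt z))"
      using p Cost_mix[of p] by (intro INF_lower2[of "bind p Qopt"]) (auto simp: tilde_plans_def)
  qed
  moreover have "(INF p\<in>?T. ext_integral p (\<lambda>z. Cost c (Qopt z))) \<le> (INF \<pi>\<in>?R \<mu> \<nu>. Cost c \<pi>)"
  proof (rule INF_greatest)
    fix \<pi> assume \<pi>: "\<pi> \<in> ?R \<mu> \<nu>"
    define p where "p = restr_to_subalg \<pi> AB0"
    have \<pi>_P: "\<pi> \<in> space (prob_algebra borel)" and marg: "distr \<pi> borel fst = \<mu>" "distr \<pi> borel snd = \<nu>"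
      using \<pi> by (auto simp: restricted_plans_def restricted_probs_def with_marginals_in_def)
    have sets_\<pi>: "sets \<pi> = sets borel"
      using \<pi>_P by (simp add: space_prob_algebra)
    have p_P: "p \<in> space (prob_algebra AB0)"
      unfolding p_def by (rule restr_to_subalg_in_prob_algebra[OF sub \<pi>_P])
    have "fst \<in> \<pi> \<rightarrow>\<^sub>M borel" "snd \<in> \<pi> \<rightarrow>\<^sub>M borel"
      using fst_snd_measurable_borel sets_\<pi> by (simp_all cong: measurable_cong_sets)
    then have "distr p A0 fst = restr_to_subalg \<mu> A0" "distr p B0 snd = restr_to_subalg \<nu> B0"
      unfolding p_def marg[symmetric]
      using subalgebra_cong[OF sub sets_\<pi>] proj subX subY by (auto intro: distr_restr_to_subalg)
    with p_P have "p \<in> ?T"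
      by (simp add: tilde_plans_def)
    then have "(INF p\<in>?T. ext_integral p (\<lambda>z. Cost c (Qopt z))) \<le> Cost c (bind p Qopt)"
      using Cost_mix[OF p_P] by (intro INF_lower2[of p]) auto
    \<comment> \<open>The optimality of \<open>Qopt\<close> is used here against the competitor
      \<open>QM\<close> with the same mixing measure \<open>p\<close>.\<close>
    also have "\<dots> \<le> Cost c (bind p QM)"
      unfolding p_def
      by (intro least simplex_kernel_in_Theta[OF X Y assms(7) erg assms(9) \<pi>])
    also have "bind p QM = \<pi>"
      using simplex_kernel_in_Theta[OF X Y assms(7) erg assms(9) \<pi>] by (simp add: Theta_def p_def)
    finally show "(INF p\<in>?T. ext_integral p (\<lambda>z. Cost c (Qopt z))) \<le> Cost c \<pi>" .
  qed
  \<comment> \<open>The cost of \<open>Qopt\<close> attains the inner infimum at every point, so the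
    integrands agree as functions and the last two infima coincide term by term.\<close>
  moreover have "(\<lambda>z. Cost c (Qopt z)) = (\<lambda>(x, y). INF \<pi>\<in>?R (QX x) (QY y). Cost c \<pi>)"
    by (auto simp: opt)
  ultimately show ?thesis
    by simp
qed

end
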